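(* Let $k$ be a field of characteristic zero, let $t, n \ge 1$ be integers, and let $\mathrm{G}(-)$ be one of $\mathrm{GL}_t(-)$, $\mathrm{SL}_t(-)$, $\mathrm{O}_t(-)$, or $\mathrm{Sp}_t(-)$ (with $t$ even in the last case). Let $C := \mathrm{G}(\mathbb{C}) \cap \mathrm{U}_t(\mathbb{C})$, a compact Lie group. Let $Y = [y_{ij}]$ be a $t \times n$ matrix of indeterminates, and let $\mathrm{G}(k)$ act on $k[Y]$ by $k$-algebra automorphisms, where $M \in \mathrm{G}(k)$ acts by $Y \mapsto MY$. Let $U = [u_{ij}]$ be a $t \times t$ matrix of new indeterminates, and let $\phi \colon k[Y] \to k[Y][U]$ be the $k$-algebra homomorphism with $Y \mapsto UY$. For $f \in k[Y]$ write $\phi(f) = \sum_{I} \alpha_I(f)\, u^I$ with $\alpha_I(f) \in k[Y]$, where $I$ runs over multi-indices in $\mathbb{N}^{t^2}$ and $u^I$ is the corresponding monomial. Then the Reynolds operator $\mathcal{R} \colon k[Y] \to k[Y]^{\mathrm{G}(k)}$ is given by $$\mathcal{R}(f) = \sum_{I} \alpha_I(f) \int_C u^I,$$ where $u^I$ is regarded as a smooth function $C \to \mathbb{C}$ and the integrals, which are rational numbers, are regarded as elements of $k$.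
   Context: $\mathrm{O}_t(k) = \{M \in \mathrm{GL}_t(k) : M^{\mathrm{tr}} M = I_t\}$; for $t = 2s$, $\mathrm{Sp}_t(k) = \{M \in \mathrm{GL}_t(k) : M^{\mathrm{tr}} \Omega M = \Omega\}$ with $\Omega = \begin{pmatrix} O & I_s \\ -I_s & O\end{pmatrix}$; $\mathrm{U}_t(\mathbb{C})$ is the unitary group. The action "$Y \mapsto MY$" means $y_{ij} \mapsto [MY]_{ij}$. The integral $\int_C$ is with respect to the normalised Haar measure on $C$ (total mass $1$). The Reynolds operator for the action of $G = \mathrm{G}(k)$ on a polynomial ring $S$ is the unique $k$-linear map $\mathcal{R} \colon S \to S^G$ with $\mathcal{R}(r) = r$ for all $r \in S^G$ and $\mathcal{R}(g(s)) = \mathcal{R}(s)$ for all $g \in G$, $s \in S$; it exists and is unique because these groups are linearly reductive in characteristic zero, and it is $S^G$-linear. *)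

theory Defs
  imports "HOL-Probability.Probability" "HOL-Library.Poly_Mapping"
begin

section \<open>Polynomials\<close>

text \<open>
  Polynomials in the indeterminates \<open>'v\<close> over \<open>'a\<close> are finitely supported maps from exponent
  vectors to coefficients; the ring structure is the convolution product of
  \<^theory>\<open>HOL-Library.Poly_Mapping\<close>. In particular \<open>Poly_Mapping.lookup p m\<close> is the
  coefficient of the monomial with exponent vector \<open>m\<close>.
\<close>

type_synonym ('v, 'a) mpoly = "('v \<Rightarrow>\<^sub>0 nat) \<Rightarrow>\<^sub>0 'a"

definition mconst :: "'a::zero \<Rightarrow> ('v, 'a) mpoly" where
  "mconst c = Poly_Mapping.single 0 c"

definition mvar :: "'v \<Rightarrow> ('v, 'a::zero_neq_one) mpoly" where
  "mvar v = Poly_Mapping.single (Poly_Mapping.single v 1) 1"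

text \<open>
  For a ring homomorphism \<open>c\<close> from the coefficients to a commutative ring, \<open>mpoly_hom c x\<close> is the
  unique ring homomorphism that extends \<open>c\<close> and sends each indeterminate \<open>v\<close> to \<open>x v\<close>.
\<close>

definition mpoly_hom ::
  "('a::zero \<Rightarrow> 'r::comm_semiring_1) \<Rightarrow> ('v \<Rightarrow> 'r) \<Rightarrow> ('v, 'a) mpoly \<Rightarrow> 'r" where
  "mpoly_hom c x p =
     (\<Sum>m\<in>Poly_Mapping.keys p.
        c (Poly_Mapping.lookup p m) *
        (\<Prod>v\<in>Poly_Mapping.keys m. x v ^ Poly_Mapping.lookup m v))"

text \<open>The generic matrix, whose entries are the indeterminates indexed by pairs (row, column).\<close>

definition var_matrix :: "('i \<times> 'j, 'a::zero_neq_one) mpoly ^ 'j ^ 'i" where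
  "var_matrix = (\<chi> i j. mvar (i, j))"


section \<open>The classical groups\<close>

datatype classical_group = General_Linear | Special_Linear | Orthogonal | Symplectic

text \<open>
  A matrix has its rows in a definite order, and the block form of \<open>\<Omega>\<close> depends on it. The index
  type \<open>'t\<close> is therefore linearly ordered; \<open>row_index\<close> numbers it by \<open>0, \<dots>, t - 1\<close>.
\<close>

definition row_index :: "'t::{finite,linorder} \<Rightarrow> nat" where
  "row_index i = card {j. j < i}"

text \<open>With \<open>t = 2 * s\<close>, this is the block matrix with rows \<open>(0, I)\<close> and \<open>(- I, 0)\<close>.\<close>

definition Omega :: "'a::comm_ring_1 ^ 't::{finite,linorder} ^ 't::{finite,linorder}" where
  "Omega = (let s = CARD('t) div 2 in
     (\<chi> i j. if row_index j = row_index i + s then 1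
             else if row_index i = row_index j + s then - 1
             else 0))"

text \<open>\<open>points G\<close> is the group \<open>G(k)\<close>; the case \<open>Symplectic\<close> is meaningful only for even \<open>t\<close>.\<close>

fun points ::
  "classical_group \<Rightarrow> ('k::field ^ 't::{finite,linorder} ^ 't::{finite,linorder}) set" where
  "points General_Linear = {M. invertible M}"
| "points Special_Linear = {M. invertible M \<and> det M = 1}"
| "points Orthogonal = {M. invertible M \<and> transpose M ** M = mat 1}"
| "points Symplectic = {M. invertible M \<and> transpose M ** Omega ** M = Omega}"

definition unitary_group :: "(complex ^ 't ^ 't::finite) set" where
  "unitary_group = {M. invertible M \<and> map_matrix cnj (transpose M) ** M = mat 1}"

definition compact_form ::
  "classical_group \<Rightarrow> (complex ^ 't::{finite,linorder} ^ 't::{finite,linorder}) set" where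
  "compact_form G = points G \<inter> unitary_group"


section \<open>Normalised Haar measure\<close>

text \<open>
  For a compact group of matrices, the left-invariant Borel probability measure is unique; it is
  automatically right-invariant and regular.
\<close>

definition normalised_haar_measure ::
  "(complex ^ 't ^ 't::finite) set \<Rightarrow> (complex ^ 't ^ 't) measure \<Rightarrow> bool" where
  "normalised_haar_measure C \<mu> \<longleftrightarrow>
     sets \<mu> = sets (restrict_space borel C) \<and>
     prob_space \<mu> \<and>
     (\<forall>M\<in>C. \<forall>A\<in>sets \<mu>. emeasure \<mu> ((\<lambda>N. M ** N) ` A) = emeasure \<mu> A)"

definition monomial_function :: "('t \<times> 't \<Rightarrow>\<^sub>0 nat) \<Rightarrow> complex ^ 't ^ 't::finite \<Rightarrow> complex" where
  "monomial_function I M = (\<Prod>(i, j)\<in>UNIV. (M $ i $ j) ^ Poly_Mapping.lookup I (i, j))"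


section \<open>The group action and the Reynolds operator\<close>

definition act ::
  "'k::field ^ 't ^ 't::finite \<Rightarrow> ('t \<times> 'n::finite, 'k) mpoly \<Rightarrow> ('t \<times> 'n, 'k) mpoly" where
  "act M = mpoly_hom mconst (\<lambda>(i, j). (map_matrix mconst M ** var_matrix) $ i $ j)"

definition invariants ::
  "('k::field ^ 't ^ 't::finite) set \<Rightarrow> ('t \<times> 'n::finite, 'k) mpoly set" where
  "invariants G = {f. \<forall>M\<in>G. act M f = f}"

definition is_reynolds_operator ::
  "('k::field ^ 't ^ 't::finite) set \<Rightarrow>
   (('t \<times> 'n::finite, 'k) mpoly \<Rightarrow> ('t \<times> 'n, 'k) mpoly) \<Rightarrow> bool" where
  "is_reynolds_operator G R \<longleftrightarrow>
     Vector_Spaces.linear (\<lambda>c p. mconst c * p) (\<lambda>c p. mconst c * p) R \<and>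
     (\<forall>f. R f \<in> invariants G) \<and>
     (\<forall>r\<in>invariants G. R r = r) \<and>
     (\<forall>M\<in>G. \<forall>f. R (act M f) = R f)"

definition reynolds_operator ::
  "('k::field ^ 't ^ 't::finite) set \<Rightarrow>
   ('t \<times> 'n::finite, 'k) mpoly \<Rightarrow> ('t \<times> 'n, 'k) mpoly" where
  "reynolds_operator G = (THE R. is_reynolds_operator G R)"

text \<open>
  The homomorphism \<open>\<phi>\<close> from \<open>k[Y]\<close> to \<open>k[Y][U]\<close> with \<open>Y \<mapsto> U Y\<close>. The target consists of the
  polynomials in \<open>U\<close> with coefficients in \<open>k[Y]\<close>, so the coefficients of \<open>\<phi> f\<close> lie in \<open>k[Y]\<close>.
\<close>

definition phi ::
  "('t::finite \<times> 'n::finite, 'k::field) mpoly \<Rightarrow> ('t \<times> 't, ('t \<times> 'n, 'k) mpoly) mpoly" where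
  "phi = mpoly_hom (\<lambda>c. mconst (mconst c))
           (\<lambda>(i, j). (var_matrix ** map_matrix mconst var_matrix) $ i $ j)"

definition alpha ::
  "('t \<times> 't \<Rightarrow>\<^sub>0 nat) \<Rightarrow> ('t::finite \<times> 'n::finite, 'k::field) mpoly \<Rightarrow> ('t \<times> 'n, 'k) mpoly" where
  "alpha I f = Poly_Mapping.lookup (phi f) I"

end

theory Submission
  imports Defs "HOL-Computational_Algebra.Polynomial"
begin

text \<open>
  Let \<open>L\<close> be the functional on \<open>k[U]\<close> that sends \<open>u\<^sup>I\<close> to its Haar integral. The value of
  the averaging operator at a point \<open>Y\<close> is \<open>L(f(UY))\<close>, so it is the Reynolds operator as soon as \<open>L\<close>
  is normalised, is invariant under left and right translation by \<open>G(k)\<close>, and vanishes on the polynomials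
  that vanish on \<open>G(k)\<close>; uniqueness follows by applying another Reynolds operator to the
  coefficients of \<open>\<phi>(f)\<close>.

  Over \<open>\<complex>\<close> these properties hold for the compact form. They are carried to \<open>k\<close> through the rational
  points: \<open>G(\<rat>)\<close> lies in the Zariski closure of the compact form and is itself Zariski dense in \<open>G(k)\<close>.
  Both density statements come from moving along rational curves, mostly obtained from the Cayley transform.
  The integrals are rational because a \<open>\<rat>\<close>-linear retraction \<open>\<complex> \<rightarrow> \<rat>\<close>, applied to them, yields
  a functional with the same properties, and those properties determine the functional.
\<close>

section \<open>Polynomials and their values\<close>

text \<open>No ring homomorphism can carry out the transfer: \<open>k\<close> need not embed into
  \<complex>, nor \<complex> into \<open>k\<close>. Only rational matrices are common to both sides,
  and coefficients are linked only by \<rat>-linear maps to \<rat>. These suffice because every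
  property asked of \<open>L\<close> is linear in the polynomial, and evaluation at a rational
  matrix, or translation by one, forms rational combinations of its coefficients. The functional
  over \<open>k\<close> is thus built from rational weights before these are known to be the
  integrals. Density is needed in both directions. For \<open>k\<close> = \<complex> the density of
  G(\<rat>) places the compact form in the closure of G(\<rat>), which gives the vanishing property;
  the converse inclusion carries invariance from the compact form to G(\<rat>), and from there it
  spreads to G(k). The obstacle to the Cayley transform is the eigenvalue -1, which every orthogonal
  matrix of determinant -1 has. Isometries that shrink this eigenspace remove it for the two
  form-preserving groups, a unimodular scalar for the linear ones. The measure is assumed to be left
  invariant only; right invariance comes from the same uniqueness argument as rationality.\<close>

definition semiring_hom :: "('a::semiring_1 \<Rightarrow> 'b::semiring_1) \<Rightarrow> bool" where
  "semiring_hom h \<longleftrightarrow> h 0 = 0 \<and> h 1 = 1 \<and> (\<forall>a b. h (a + b) = h a + h b) \<and> (\<forall>a b. h (a * b) = h a * h b)"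

lemma semiring_hom_simps:
  assumes "semiring_hom h"
  shows "h 0 = 0" "h 1 = 1" "h (a + b) = h a + h b" "h (a * b) = h a * h b"
  using assms by (auto simp: semiring_hom_def)

lemma semiring_hom_sum:
  assumes "semiring_hom h" shows "h (sum f A) = (\<Sum>a\<in>A. h (f a))"
  by (induction A rule: infinite_finite_induct) (auto simp: semiring_hom_simps[OF assms])

lemma semiring_hom_power:
  assumes "semiring_hom h" shows "h (a ^ n) = h a ^ n"
  by (induction n) (auto simp: semiring_hom_simps[OF assms])

lemma semiring_hom_prod:
  fixes h :: "'a::comm_semiring_1 \<Rightarrow> 'b::comm_semiring_1"
  assumes "semiring_hom h" shows "h (prod f A) = (\<Prod>a\<in>A. h (f a))"
  by (induction A rule: infinite_finite_induct) (auto simp: semiring_hom_simps[OF assms])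

lemma semiring_hom_id: "semiring_hom (\<lambda>x. x)"
  by (auto simp: semiring_hom_def)

lemma semiring_hom_of_rat: "semiring_hom (of_rat :: rat \<Rightarrow> 'k::field_char_0)"
  by (auto simp: semiring_hom_def of_rat_add of_rat_mult)

definition monom_val :: "('v::finite \<Rightarrow> 'a::comm_semiring_1) \<Rightarrow> ('v \<Rightarrow>\<^sub>0 nat) \<Rightarrow> 'a" where
  "monom_val x m = (\<Prod>v\<in>UNIV. x v ^ Poly_Mapping.lookup m v)"

lemma monom_val_keys:
  fixes x :: "'v::finite \<Rightarrow> 'a::comm_semiring_1"
  shows "(\<Prod>v\<in>Poly_Mapping.keys m. x v ^ Poly_Mapping.lookup m v) = monom_val x m"
  unfolding monom_val_def by (rule prod.mono_neutral_left) (auto simp: in_keys_iff)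

lemma monom_val_0 [simp]: "monom_val x 0 = 1"
  by (simp add: monom_val_def)

lemma monom_val_add: "monom_val x (m + m') = monom_val x m * monom_val x m'"
  by (simp add: monom_val_def lookup_add power_add prod.distrib)

lemma monom_val_mult: "monom_val (\<lambda>v. x v * y v) m = monom_val x m * monom_val y m"
  by (simp add: monom_val_def power_mult_distrib prod.distrib)

lemma monom_val_single: "monom_val x (Poly_Mapping.single v 1) = x v"
proof -
  have "monom_val x (Poly_Mapping.single v 1) = (\<Prod>w\<in>UNIV. if w = v then x v else 1)"
    unfolding monom_val_def by (intro prod.cong) (auto simp: lookup_single when_def)
  then show ?thesis by simp
qed

lemma hom_monom_val: "semiring_hom h \<Longrightarrow> h (monom_val x m) = monom_val (\<lambda>v. h (x v)) m"
  unfolding monom_val_def by (simp add: semiring_hom_prod semiring_hom_power)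

lemma mpoly_hom_eq:
  fixes x :: "'v::finite \<Rightarrow> 'r::comm_semiring_1"
  shows "mpoly_hom c x p = (\<Sum>m\<in>Poly_Mapping.keys p. c (Poly_Mapping.lookup p m) * monom_val x m)"
  by (simp add: mpoly_hom_def monom_val_keys)

lemma mpoly_hom_superset:
  assumes "c 0 = 0" "finite A" "Poly_Mapping.keys p \<subseteq> A"
  shows "mpoly_hom c x p = (\<Sum>m\<in>A. c (Poly_Mapping.lookup p m) * monom_val x m)"
  unfolding mpoly_hom_eq using assms
  by (intro sum.mono_neutral_left) (auto simp: in_keys_iff)

lemma mpoly_hom_single: "c 0 = 0 \<Longrightarrow> mpoly_hom c x (Poly_Mapping.single m a) = c a * monom_val x m"
  by (subst mpoly_hom_superset[where A = "{m}"]) auto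

lemma mpoly_hom_add:
  fixes x :: "'v::finite \<Rightarrow> 'r::comm_semiring_1"
  assumes "c 0 = 0" "\<And>a b. c (a + b) = c a + c b"
  shows "mpoly_hom c x (p + q) = mpoly_hom c x p + mpoly_hom c x q"
proof -
  let ?A = "Poly_Mapping.keys p \<union> Poly_Mapping.keys q"
  have "mpoly_hom c x r = (\<Sum>m\<in>?A. c (Poly_Mapping.lookup r m) * monom_val x m)"
    if "r \<in> {p, q, p + q}" for r
    using that keys_add[of p q] by (intro mpoly_hom_superset) (auto simp: assms)
  then show ?thesis
    by (simp add: lookup_add assms distrib_right sum.distrib)
qed

lemma mpoly_sum_singles:
  assumes "finite A" "Poly_Mapping.keys p \<subseteq> A"
  shows "(\<Sum>m\<in>A. Poly_Mapping.single m (Poly_Mapping.lookup p m)) = p"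
proof (rule poly_mapping_eqI)
  fix k
  have "(\<Sum>m\<in>A. Poly_Mapping.lookup p m when m = k) = (\<Sum>m\<in>A. if m = k then Poly_Mapping.lookup p k else 0)"
    by (intro sum.cong) (auto simp: when_def)
  then show "Poly_Mapping.lookup (\<Sum>m\<in>A. Poly_Mapping.single m (Poly_Mapping.lookup p m)) k
      = Poly_Mapping.lookup p k"
    using assms by (auto simp: lookup_sum lookup_single in_keys_iff)
qed

lemma mpoly_hom_sum:
  fixes x :: "'v::finite \<Rightarrow> 'r::comm_semiring_1"
  assumes "c 0 = 0" "\<And>a b. c (a + b) = c a + c b"
  shows "mpoly_hom c x (sum f A) = (\<Sum>a\<in>A. mpoly_hom c x (f a))"
  by (induction A rule: infinite_finite_induct)
     (auto simp: mpoly_hom_add assms, simp_all add: mpoly_hom_def)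

lemma mpoly_hom_mult:
  fixes x :: "'v::finite \<Rightarrow> 'r::comm_semiring_1" and c :: "'a::comm_semiring_1 \<Rightarrow> 'r"
  assumes "semiring_hom c"
  shows "mpoly_hom c x (p * q) = mpoly_hom c x p * mpoly_hom c x q"
proof -
  note [simp] = semiring_hom_simps[OF assms]
  define s where "s r m = Poly_Mapping.single m (Poly_Mapping.lookup r m)" for r :: "('v, 'a) mpoly" and m
  have s: "(\<Sum>m\<in>Poly_Mapping.keys r. s r m) = r" for r
    unfolding s_def by (rule mpoly_sum_singles) auto
  have 1: "mpoly_hom c x (s p m * s q n) = mpoly_hom c x (s p m) * mpoly_hom c x (s q n)" for m n
    by (simp add: s_def mult_single mpoly_hom_single monom_val_add mult_ac)
  have "mpoly_hom c x ((\<Sum>m\<in>Poly_Mapping.keys p. s p m) * (\<Sum>n\<in>Poly_Mapping.keys q. s q n))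
     = mpoly_hom c x (\<Sum>m\<in>Poly_Mapping.keys p. s p m) * mpoly_hom c x (\<Sum>n\<in>Poly_Mapping.keys q. s q n)"
    by (simp add: sum_product mpoly_hom_sum 1)
  then show ?thesis unfolding s .
qed

lemma semiring_hom_mpoly_hom:
  fixes x :: "'v::finite \<Rightarrow> 'r::comm_semiring_1" and c :: "'a::comm_semiring_1 \<Rightarrow> 'r"
  assumes "semiring_hom c" shows "semiring_hom (mpoly_hom c x)"
  unfolding semiring_hom_def
  by (intro conjI allI mpoly_hom_mult[OF assms] mpoly_hom_add)
     (auto simp: semiring_hom_simps[OF assms] mpoly_hom_def lookup_one)

lemma mpoly_hom_mconst:
  fixes x :: "'v::finite \<Rightarrow> 'r::comm_semiring_1"
  shows "c 0 = 0 \<Longrightarrow> mpoly_hom c x (mconst a) = c a"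
  by (simp add: mconst_def mpoly_hom_single)

lemma mpoly_hom_mvar:
  fixes x :: "'v::finite \<Rightarrow> 'r::comm_semiring_1" and c :: "'a::comm_semiring_1 \<Rightarrow> 'r"
  assumes "semiring_hom c" shows "mpoly_hom c x (mvar v) = x v"
  using mpoly_hom_single[of c x "Poly_Mapping.single v 1" 1] monom_val_single[of x v]
  by (simp add: mvar_def semiring_hom_simps[OF assms])

lemma hom_mpoly_hom:
  fixes x :: "'v::finite \<Rightarrow> 'r::comm_semiring_1"
  assumes "semiring_hom h"
  shows "h (mpoly_hom c x p) = mpoly_hom (\<lambda>a. h (c a)) (\<lambda>v. h (x v)) p"
  by (simp add: mpoly_hom_eq semiring_hom_sum[OF assms] semiring_hom_simps[OF assms] hom_monom_val[OF assms])

lemma mpoly_hom_cong: "(\<And>a. c a = c' a) \<Longrightarrow> (\<And>v. x v = x' v) \<Longrightarrow> mpoly_hom c x p = mpoly_hom c' x' p"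
  by (metis ext)

text \<open>
  Distinct monomials are distinct characters of the multiplicative monoid of rational points, so
  Dedekind's argument shows that they are linearly independent.
\<close>

lemma monomials_independent:
  fixes a :: "('v::finite \<Rightarrow>\<^sub>0 nat) \<Rightarrow> 'k::field_char_0"
  assumes "finite A" and "\<And>x :: 'v \<Rightarrow> rat. (\<Sum>m\<in>A. a m * monom_val (\<lambda>v. of_rat (x v)) m) = 0"
  shows "\<forall>m\<in>A. a m = 0"
  using assms
proof (induction A arbitrary: a rule: finite_induct)
  case (insert n A)
  let ?e = "\<lambda>x :: 'v \<Rightarrow> rat. \<lambda>m. monom_val (\<lambda>v. of_rat (x v)) m :: 'k"
  \<comment> \<open>Subtracting \<open>?e z n\<close> times the relation at \<open>x\<close> from
    the relation at the product of \<open>z\<close> and \<open>x\<close> cancels the term of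
    \<open>n\<close> and leaves a shorter relation.\<close>
  have "(\<Sum>m\<in>A. (a m * (?e z m - ?e z n)) * ?e x m) = 0" for x z
  proof -
    have "(\<Sum>m\<in>insert n A. a m * ?e (\<lambda>v. z v * x v) m) - ?e z n * (\<Sum>m\<in>insert n A. a m * ?e x m) = 0"
      by (simp only: insert.prems) simp
    moreover have "?e (\<lambda>v. z v * x v) m = ?e z m * ?e x m" for m
      by (simp add: monom_val_mult of_rat_mult)
    ultimately show ?thesis
      using insert.hyps by (simp add: algebra_simps sum_distrib_left sum_subtractf)
  qed
  then have *: "\<forall>m\<in>A. a m * (?e z m - ?e z n) = 0" for z
    by (rule insert.IH)
  have A: "a m = 0" if m: "m \<in> A" for m
  proof -
    from m insert.hyps have "m \<noteq> n" by auto
    then obtain v where v: "Poly_Mapping.lookup m v \<noteq> Poly_Mapping.lookup n v"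
      by (meson poly_mapping_eqI)
    \<comment> \<open>The value 2 at a position where the exponents differ, and 1 elsewhere, turns
      the two monomials into different powers of 2.\<close>
    define z :: "'v \<Rightarrow> rat" where "z w = (if w = v then 2 else 1)" for w
    have z: "?e z k = 2 ^ Poly_Mapping.lookup k v" for k
    proof -
      have "?e z k = (\<Prod>w\<in>UNIV. if w = v then 2 ^ Poly_Mapping.lookup k v else 1)"
        unfolding monom_val_def by (intro prod.cong) (auto simp: z_def)
      then show ?thesis by simp
    qed
    have inj: "(2 :: 'k) ^ i = 2 ^ j \<Longrightarrow> i = j" for i j :: nat
      by (metis of_nat_eq_iff of_nat_numeral of_nat_power power_inject_exp one_less_numeral_iff semiring_norm(76))
    have "?e z m - ?e z n \<noteq> 0"
      using inj v unfolding z by auto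
    then show ?thesis using * m by auto
  qed
  moreover have "a n = 0"
    using insert.prems[of "\<lambda>_. 1"] insert.hyps A by (simp add: monom_val_def)
  ultimately show ?case by auto
qed simp

definition meval :: "'a::comm_ring_1 ^ 'j::finite ^ 'i::finite \<Rightarrow> ('i \<times> 'j, 'a) mpoly \<Rightarrow> 'a" where
  "meval M = mpoly_hom (\<lambda>c. c) (\<lambda>(i, j). M $ i $ j)"

abbreviation entry :: "'a ^ 'j::finite ^ 'i::finite \<Rightarrow> 'i \<times> 'j \<Rightarrow> 'a" where
  "entry M \<equiv> (\<lambda>(i, j). M $ i $ j)"

lemma semiring_hom_meval: "semiring_hom (meval M)"
  unfolding meval_def by (intro semiring_hom_mpoly_hom semiring_hom_id)

lemmas meval_hom = semiring_hom_simps[OF semiring_hom_meval] semiring_hom_sum[OF semiring_hom_meval]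

lemma meval_mconst [simp]: "meval M (mconst a) = a"
  by (simp add: meval_def mpoly_hom_mconst)

lemma meval_mvar [simp]: "meval M (mvar (i, j)) = M $ i $ j"
  by (simp add: meval_def mpoly_hom_mvar semiring_hom_id)

lemma meval_uminus: "meval M (- p) = - meval M p"
  using meval_hom(3)[of M p "- p"] by (simp add: meval_hom eq_neg_iff_add_eq_0 add.commute)

lemma meval_diff: "meval M (p - q) = meval M p - meval M q"
  using meval_hom(3)[of M p "- q"] by (simp add: meval_uminus)

lemma meval_eq: "meval M p = (\<Sum>m\<in>Poly_Mapping.keys p. Poly_Mapping.lookup p m * monom_val (entry M) m)"
  by (simp add: meval_def mpoly_hom_eq)

lemma meval_superset:
  assumes "finite A" "Poly_Mapping.keys p \<subseteq> A"
  shows "meval M p = (\<Sum>m\<in>A. Poly_Mapping.lookup p m * monom_val (entry M) m)"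
  using mpoly_hom_superset[OF _ assms, of "\<lambda>c. c"] by (simp add: meval_def)

lemma meval_single [simp]: "meval M (Poly_Mapping.single m a) = a * monom_val (entry M) m"
  by (simp add: meval_def mpoly_hom_single)

text \<open>Monomials remain independent as functions of rational points. Testing at rational
  matrices alone is what later makes \<open>map_coeffs\<close> comparable with translations,
  although it is not multiplicative.\<close>

lemma meval_eqI:
  fixes p q :: "('i::finite \<times> 'j::finite, 'k::field_char_0) mpoly"
  assumes "\<And>M :: rat ^ 'j ^ 'i. meval (map_matrix of_rat M) p = meval (map_matrix of_rat M) q"
  shows "p = q"
proof -
  let ?r = "p - q"
  have "\<forall>m\<in>Poly_Mapping.keys ?r. Poly_Mapping.lookup ?r m = 0"
  proof (rule monomials_independent)
    fix x :: "'i \<times> 'j \<Rightarrow> rat"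
    have *: "entry (map_matrix of_rat (\<chi> i j. x (i, j))) = (\<lambda>v. of_rat (x v) :: 'k)" by auto
    have "meval (map_matrix of_rat (\<chi> i j. x (i, j))) ?r = 0"
      using assms[of "\<chi> i j. x (i, j)"] by (simp only: meval_diff) simp
    then show "(\<Sum>m\<in>Poly_Mapping.keys ?r. Poly_Mapping.lookup ?r m * monom_val (\<lambda>v. of_rat (x v)) m) = 0"
      unfolding meval_eq * .
  qed auto
  then have "\<forall>m. Poly_Mapping.lookup ?r m = 0" by (auto simp: in_keys_iff simp del: lookup_minus)
  then show ?thesis
    by (intro poly_mapping_eqI) (simp add: lookup_minus)
qed

subsection \<open>The action and the generic substitution\<close>

lemma meval_act: "meval Y (act M f) = meval (M ** Y) f"
proof -
  have "meval Y (act M f) = mpoly_hom (\<lambda>a. meval Y (mconst a))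
     (\<lambda>v. meval Y (case v of (i, j) \<Rightarrow> (map_matrix mconst M ** var_matrix) $ i $ j)) f"
    unfolding act_def by (rule hom_mpoly_hom[OF semiring_hom_meval])
  also have "\<dots> = meval (M ** Y) f"
    unfolding meval_def[of "M ** Y"]
    by (rule mpoly_hom_cong)
       (auto simp: matrix_matrix_mult_def var_matrix_def meval_hom)
  finally show ?thesis .
qed

lemma meval_phi:
  "mpoly_hom (meval Y) (entry U) (phi f) = meval (U ** Y) f"
proof -
  note hom = semiring_hom_mpoly_hom[OF semiring_hom_meval, of Y "entry U"]
  have "mpoly_hom (meval Y) (entry U) (phi f) =
     mpoly_hom (\<lambda>c. mpoly_hom (meval Y) (entry U) (mconst (mconst c)))
       (\<lambda>v. mpoly_hom (meval Y) (entry U)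
          (case v of (i, j) \<Rightarrow> (var_matrix ** map_matrix mconst var_matrix) $ i $ j)) f"
    unfolding phi_def by (rule hom_mpoly_hom[OF hom])
  also have "\<dots> = meval (U ** Y) f"
    unfolding meval_def[of "U ** Y"]
    by (rule mpoly_hom_cong)
       (auto simp: matrix_matrix_mult_def var_matrix_def mpoly_hom_mconst meval_hom
          semiring_hom_simps[OF hom] semiring_hom_sum[OF hom] mpoly_hom_mvar[OF semiring_hom_meval])
  finally show ?thesis .
qed

text \<open>\<open>subst_right Y f\<close> is \<open>f(UY)\<close> as a polynomial in \<open>U\<close>, for a fixed matrix \<open>Y\<close>.\<close>

definition subst_right ::
  "'k::field ^ 'n::finite ^ 't::finite \<Rightarrow> ('t \<times> 'n, 'k) mpoly \<Rightarrow> ('t \<times> 't, 'k) mpoly" where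
  "subst_right Y f = (\<Sum>I\<in>Poly_Mapping.keys (phi f). Poly_Mapping.single I (meval Y (alpha I f)))"

lemma lookup_subst_right: "Poly_Mapping.lookup (subst_right Y f) I = meval Y (alpha I f)"
proof -
  have "(\<Sum>J\<in>Poly_Mapping.keys (phi f). meval Y (alpha J f) when J = I)
      = (\<Sum>J\<in>Poly_Mapping.keys (phi f). if J = I then meval Y (alpha I f) else 0)"
    by (intro sum.cong) (auto simp: when_def)
  then show ?thesis
    by (auto simp: subst_right_def lookup_sum lookup_single in_keys_iff alpha_def meval_hom)
qed

lemma meval_subst_right: "meval U (subst_right Y f) = meval (U ** Y) f"
  unfolding subst_right_def meval_phi[symmetric] mpoly_hom_eq alpha_def
  by (simp add: meval_hom)

lemma keys_subst_right: "Poly_Mapping.keys (subst_right Y f) \<subseteq> {I. alpha I f \<noteq> 0}"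
  by (auto simp: in_keys_iff lookup_subst_right meval_hom)

lemma alpha_support: "{I. alpha I f \<noteq> 0} = Poly_Mapping.keys (phi f)"
  by (auto simp: alpha_def in_keys_iff)

text \<open>Substituting the entries of \<open>M\<close> for \<open>U\<close> in
  \<open>phi f\<close> gives the action. In the uniqueness proof this lets a linear operator be
  applied to \<open>act M f\<close> coefficient by coefficient.\<close>

lemma act_eq_alpha:
  fixes f :: "('t::finite \<times> 'n::finite, 'k::field_char_0) mpoly"
  shows "act M f = (\<Sum>I | alpha I f \<noteq> 0. mconst (monom_val (entry M) I) * alpha I f)"
proof (rule meval_eqI)
  fix Y :: "rat ^ 'n ^ 't"
  let ?Y = "map_matrix of_rat Y :: 'k ^ 'n ^ 't"
  have "meval ?Y (act M f) = meval M (subst_right ?Y f)"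
    by (simp add: meval_act meval_subst_right)
  also have "\<dots> = (\<Sum>I | alpha I f \<noteq> 0. Poly_Mapping.lookup (subst_right ?Y f) I * monom_val (entry M) I)"
    by (rule meval_superset) (auto simp: alpha_support keys_subst_right[unfolded alpha_support])
  also have "\<dots> = meval ?Y (\<Sum>I | alpha I f \<noteq> 0. mconst (monom_val (entry M) I) * alpha I f)"
    by (simp add: meval_hom lookup_subst_right mult.commute)
  finally show "meval ?Y (act M f) = meval ?Y (\<Sum>I | alpha I f \<noteq> 0. mconst (monom_val (entry M) I) * alpha I f)" .
qed

text \<open>The outer \<open>subst_right M\<close> is right translation on k[U]: right invariance of
  a functional thus makes the averaged polynomial invariant. The next lemma turns the action on the
  argument into left translation in the same way.\<close>

lemma subst_right_subst_right:
  fixes f :: "('t::finite \<times> 'n::finite, 'k::field_char_0) mpoly"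
  shows "subst_right (M ** Y) f = subst_right M (subst_right Y f)"
  by (rule meval_eqI) (simp add: meval_subst_right matrix_mul_assoc)

lemma subst_right_act:
  fixes f :: "('t::finite \<times> 'n::finite, 'k::field_char_0) mpoly"
  shows "subst_right Y (act M f) = act M (subst_right Y f)"
  by (rule meval_eqI) (simp add: meval_subst_right meval_act matrix_mul_assoc)

subsection \<open>Linear functionals given by weights on the monomials\<close>

text \<open>Storing a functional by its values on monomials lets one table of rational numbers
  define a functional over every field of characteristic zero.\<close>

definition weight_sum :: "(('v \<Rightarrow>\<^sub>0 nat) \<Rightarrow> 'a) \<Rightarrow> ('v, 'a::comm_semiring_1) mpoly \<Rightarrow> 'a" where
  "weight_sum w p = (\<Sum>m\<in>Poly_Mapping.keys p. Poly_Mapping.lookup p m * w m)"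

lemma weight_sum_superset:
  assumes "finite A" "Poly_Mapping.keys p \<subseteq> A"
  shows "weight_sum w p = (\<Sum>m\<in>A. Poly_Mapping.lookup p m * w m)"
  unfolding weight_sum_def using assms by (intro sum.mono_neutral_left) (auto simp: in_keys_iff)

lemma weight_sum_single [simp]: "weight_sum w (Poly_Mapping.single m a) = a * w m"
  by (subst weight_sum_superset[where A = "{m}"]) auto

lemma weight_sum_0 [simp]: "weight_sum w 0 = 0"
  by (simp add: weight_sum_def)

lemma weight_sum_add: "weight_sum w (p + q) = weight_sum w p + weight_sum w q"
proof -
  let ?A = "Poly_Mapping.keys p \<union> Poly_Mapping.keys q"
  have "weight_sum w r = (\<Sum>m\<in>?A. Poly_Mapping.lookup r m * w m)" if "r \<in> {p, q, p + q}" for r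
    using that keys_add[of p q] by (intro weight_sum_superset) auto
  then show ?thesis by (simp add: lookup_add distrib_right sum.distrib)
qed

lemma weight_sum_sum: "weight_sum w (sum f A) = (\<Sum>a\<in>A. weight_sum w (f a))"
  by (induction A rule: infinite_finite_induct) (auto simp: weight_sum_add)

lemma weight_sum_diff:
  fixes w :: "('v \<Rightarrow>\<^sub>0 nat) \<Rightarrow> 'a::comm_ring_1"
  shows "weight_sum w (p - q) = weight_sum w p - weight_sum w q"
  using weight_sum_add[of w "p - q" q] by simp

lemma weight_sum_smult:
  "weight_sum w (mconst c * p) = c * weight_sum w (p :: ('v, 'a::comm_semiring_1) mpoly)"
proof -
  have "p = (\<Sum>m\<in>Poly_Mapping.keys p. Poly_Mapping.single m (Poly_Mapping.lookup p m))"
    by (rule mpoly_sum_singles[symmetric]) auto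
  then have "mconst c * p = (\<Sum>m\<in>Poly_Mapping.keys p. Poly_Mapping.single m (c * Poly_Mapping.lookup p m))"
    by (metis (no_types, lifting) mconst_def mult_single sum_distrib_left sum.cong add_0)
  then show ?thesis
    by (simp add: weight_sum_sum) (simp add: weight_sum_def sum_distrib_left mult.assoc)
qed

section \<open>Matrix algebra\<close>

lemma matrix_sub_ldistrib: "A ** (B - C) = A ** B - A ** (C :: 'a::ring_1 ^ 'n ^ 'm)"
  by (simp add: matrix_matrix_mult_def vec_eq_iff right_diff_distrib sum_subtractf)

lemma matrix_sub_rdistrib: "(B - C) ** A = B ** A - C ** (A :: 'a::ring_1 ^ 'n ^ 'm)"
  by (simp add: matrix_matrix_mult_def vec_eq_iff left_diff_distrib sum_subtractf)

lemma matrix_neg_left: "(- A) ** B = - (A ** (B :: 'a::ring_1 ^ 'n ^ 'm))"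
  by (simp add: matrix_matrix_mult_def vec_eq_iff sum_negf)

lemma matrix_neg_right: "A ** (- B) = - (A ** (B :: 'a::ring_1 ^ 'n ^ 'm))"
  by (simp add: matrix_matrix_mult_def vec_eq_iff sum_negf)

lemma matrix_add_rdistrib: "(B + C) ** A = B ** A + C ** (A :: 'a::semiring_1 ^ 'n ^ 'm)"
  by (simp add: matrix_matrix_mult_def vec_eq_iff distrib_right sum.distrib)

lemmas matrix_ring = matrix_add_ldistrib matrix_add_rdistrib matrix_sub_ldistrib matrix_sub_rdistrib
  matrix_neg_left matrix_neg_right matrix_mul_assoc

lemma transpose_add: "transpose (A + B) = transpose A + transpose B"
  by (simp add: transpose_def vec_eq_iff)

lemma transpose_diff: "transpose (A - B) = transpose A - transpose B"
  by (simp add: transpose_def vec_eq_iff)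

lemma mat_mult_nth: "(mat c ** A) $ i $ j = c * A $ i $ j" for A :: "'a::semiring_1 ^ 'n ^ 'm"
  by (simp add: matrix_matrix_mult_def mat_def if_distrib if_distribR sum.delta cong: if_cong)

lemma mat_mult_commute: "A ** mat c = mat c ** A" for A :: "'a::comm_semiring_1 ^ 'n ^ 'm"
  by (simp add: matrix_matrix_mult_def mat_def if_distrib if_distribR sum.delta sum.delta' vec_eq_iff
      mult.commute cong: if_cong)

lemma mat_mult_mat: "mat c ** mat d = mat (c * d)"
  by (simp add: vec_eq_iff mat_mult_nth) (simp add: mat_def)

lemma det_nz_if_right_inverse: "A ** B = mat 1 \<Longrightarrow> det A \<noteq> 0" for A :: "'a::field ^ 'n ^ 'n"
  by (metis det_I det_mul mult_zero_left zero_neq_one)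

text \<open>An inverse given entrywise by determinants: that it varies rationally along curves and
  preserves rational entries can be read off the formula. For a singular matrix the value is 0,
  since \<open>x / 0 = 0\<close>.\<close>

definition cramer_inv :: "'a::field ^ 'n ^ 'n \<Rightarrow> 'a ^ 'n ^ 'n" where
  "cramer_inv A = (\<chi> k j. det (\<chi> i l. if l = k then (if i = j then 1 else 0) else A $ i $ l) / det A)"

lemma cramer_inv:
  assumes "det A \<noteq> 0"
  shows "A ** cramer_inv A = mat 1" "cramer_inv A ** A = mat 1"
proof -
  have "A *v (\<chi> k. cramer_inv A $ k $ j) = axis j 1" for j
    unfolding cramer[OF assms] by (simp add: cramer_inv_def axis_def cong: if_cong)
  then have "(A *v (\<chi> k. cramer_inv A $ k $ j)) $ i = (axis j 1) $ i" for i j by metis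
  then show "A ** cramer_inv A = mat 1"
    by (auto simp: vec_eq_iff matrix_vector_mult_def matrix_matrix_mult_def mat_def axis_def)
  then show "cramer_inv A ** A = mat 1"
    by (simp add: matrix_left_right_inverse)
qed

lemma cramer_inv_unique:
  assumes "A ** B = mat 1" shows "cramer_inv A = (B :: 'a::field ^ 'n ^ 'n)"
  by (metis assms cramer_inv(2) det_nz_if_right_inverse matrix_mul_assoc matrix_mul_lid matrix_mul_rid)

subsection \<open>The Cayley transform\<close>

definition cayley :: "'a::field ^ 'n ^ 'n \<Rightarrow> 'a ^ 'n ^ 'n" where
  "cayley X = (mat 1 - X) ** cramer_inv (mat 1 + X)"

text \<open>
  Stated for an arbitrary \<open>X'\<close> in the role of the adjoint of \<open>X\<close>, so that it covers both the
  transpose and the conjugate transpose.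
\<close>

lemma cayley_form:
  fixes X X' C' J :: "'a::field ^ 'n ^ 'n"
  assumes det: "det (mat 1 + X) \<noteq> 0" and C': "C' ** (mat 1 + X') = mat 1"
    and X: "X' ** J = - (J ** X)"
  shows "(C' ** (mat 1 - X')) ** J ** cayley X = J"
proof -
  let ?C = "cramer_inv (mat 1 + X)"
  have 1: "(mat 1 - X') ** J = J ** (mat 1 + X)" and 2: "J ** (mat 1 - X) = (mat 1 + X') ** J"
    using X by (auto simp: matrix_ring)
  have 3: "(mat 1 + X) ** (mat 1 - X) = (mat 1 - X) ** (mat 1 + X)"
    by (simp add: matrix_ring)
  have "(C' ** (mat 1 - X')) ** J ** cayley X = C' ** ((mat 1 - X') ** J) ** (mat 1 - X) ** ?C"
    by (simp add: cayley_def matrix_mul_assoc)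
  also have "\<dots> = C' ** J ** ((mat 1 + X) ** (mat 1 - X)) ** ?C"
    by (simp only: 1 matrix_mul_assoc)
  also have "\<dots> = C' ** (J ** (mat 1 - X)) ** ((mat 1 + X) ** ?C)"
    by (simp only: 3 matrix_mul_assoc)
  also have "\<dots> = (C' ** (mat 1 + X')) ** J"
    by (simp only: cramer_inv[OF det] 2 matrix_mul_assoc matrix_mul_rid)
  finally show ?thesis by (simp add: C')
qed

lemma cayley_form_transpose:
  fixes X J :: "'a::field ^ 'n ^ 'n"
  assumes det: "det (mat 1 + X) \<noteq> 0" and X: "transpose X ** J = - (J ** X)"
  shows "transpose (cayley X) ** J ** cayley X = J"
proof -
  have 3: "(mat 1 + X) ** (mat 1 - X) = (mat 1 - X) ** (mat 1 + X)"
    by (simp add: matrix_ring)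
  have "transpose (cramer_inv (mat 1 + X)) ** (mat 1 + transpose X) = mat 1"
    using arg_cong[OF cramer_inv(1)[OF det], of transpose]
    by (simp add: matrix_transpose_mul transpose_add)
  from cayley_form[OF det this X] show ?thesis
    by (simp add: cayley_def matrix_transpose_mul transpose_diff)
qed

text \<open>With C the inverse of 1 + M, one has 1 + \<open>cayley M\<close> = 2 C and 1 -
  \<open>cayley M\<close> = 2 M C, so forming the quotient again returns M. The scalar 2 has to be
  invertible here.\<close>

lemma cayley_cayley:
  fixes M :: "'a::field_char_0 ^ 'n ^ 'n"
  assumes det: "det (mat 1 + M) \<noteq> 0"
  shows "det (mat 1 + cayley M) \<noteq> 0" "cayley (cayley M) = M"
proof -
  let ?C = "cramer_inv (mat 1 + M)"
  have one: "mat 1 = (mat 1 + M) ** ?C" using cramer_inv(1)[OF det] by simp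
  have *: "M + M = mat 2 ** M" "(mat 1 :: 'a ^ 'n ^ 'n) + mat 1 = mat 2"
    by (auto simp: vec_eq_iff mat_mult_nth) (auto simp: mat_def)
  have p: "mat 1 + cayley M = mat 2 ** ?C"
    by (subst one) (simp add: cayley_def flip: matrix_add_rdistrib *(2))
  have m: "mat 1 - cayley M = mat 2 ** M ** ?C"
    by (subst one) (simp add: cayley_def flip: matrix_sub_rdistrib *(1))
  have i: "(mat 2 ** ?C) ** (mat (1/2) ** (mat 1 + M)) = mat 1"
  proof -
    have "(mat 2 ** ?C) ** (mat (1/2) ** (mat 1 + M)) = mat 2 ** (?C ** mat (1/2)) ** (mat 1 + M)"
      by (simp only: matrix_mul_assoc)
    also have "\<dots> = (mat 2 ** mat (1/2)) ** (?C ** (mat 1 + M))"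
      by (simp only: matrix_mul_assoc mat_mult_commute[of ?C])
    finally show ?thesis by (simp add: cramer_inv[OF det] mat_mult_mat)
  qed
  then show "det (mat 1 + cayley M) \<noteq> 0"
    unfolding p by (rule det_nz_if_right_inverse)
  have "cayley (cayley M) = (mat 2 ** M ** ?C) ** (mat (1/2) ** (mat 1 + M))"
    by (subst cayley_def) (simp only: p m cramer_inv_unique[OF i])
  also have "\<dots> = mat 2 ** (M ** ?C ** mat (1/2)) ** (mat 1 + M)"
    by (simp only: matrix_mul_assoc)
  also have "\<dots> = (mat 2 ** mat (1/2)) ** M ** (?C ** (mat 1 + M))"
    by (simp only: matrix_mul_assoc mat_mult_commute[of "M ** ?C"])
  finally show "cayley (cayley M) = M" by (simp add: cramer_inv[OF det] mat_mult_mat)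
qed

lemma cayley_skew:
  fixes M J :: "'a::field ^ 'n ^ 'n"
  assumes det: "det (mat 1 + M) \<noteq> 0" and M: "transpose M ** J ** M = J"
  shows "transpose (cayley M) ** J = - (J ** cayley M)"
proof -
  let ?C = "cramer_inv (mat 1 + M)" and ?A' = "mat 1 + transpose M"
  have C': "transpose ?C ** ?A' = mat 1"
    using arg_cong[OF cramer_inv(1)[OF det], of transpose]
    by (simp add: matrix_transpose_mul transpose_add)
  \<comment> \<open>Once \<open>transpose M ** J ** M\<close> is replaced by \<open>J\<close>, both
    sides are \<open>J ** M - transpose M ** J\<close>.\<close>
  have *: "(mat 1 - transpose M) ** J ** (mat 1 + M) = - (?A' ** J ** (mat 1 - M))"
    using M by (simp add: matrix_ring)
  have "transpose (cayley M) ** J = transpose ?C ** (mat 1 - transpose M) ** J ** ((mat 1 + M) ** ?C)"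
    by (simp add: cayley_def matrix_transpose_mul transpose_diff cramer_inv[OF det])
  also have "\<dots> = transpose ?C ** ((mat 1 - transpose M) ** J ** (mat 1 + M)) ** ?C"
    by (simp only: matrix_mul_assoc)
  also have "\<dots> = - ((transpose ?C ** ?A') ** J ** (mat 1 - M) ** ?C)"
    by (simp only: * matrix_neg_left matrix_neg_right matrix_mul_assoc)
  also have "\<dots> = - (J ** cayley M)"
    by (simp only: C' cayley_def matrix_mul_assoc matrix_mul_lid)
  finally show ?thesis .
qed

section \<open>Zariski closure and rational curves\<close>

definition zariski_closure :: "('k::field ^ 't::finite ^ 't) set \<Rightarrow> ('k ^ 't ^ 't) set" where
  "zariski_closure S = {M. \<forall>p. (\<forall>N\<in>S. meval N p = 0) \<longrightarrow> meval M p = 0}"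

lemma zariski_closureD: "M \<in> zariski_closure S \<Longrightarrow> (\<And>N. N \<in> S \<Longrightarrow> meval N p = 0) \<Longrightarrow> meval M p = 0"
  by (auto simp: zariski_closure_def)

lemma zariski_closure_superset: "S \<subseteq> zariski_closure S"
  by (auto simp: zariski_closure_def)

text \<open>One factor moves at a time: for \<open>C\<close> in \<open>S\<close> the left translate
  \<open>act C p\<close> vanishes on \<open>S\<close>, hence at \<open>B\<close>; so the right
  translate \<open>subst_right B p\<close> vanishes on \<open>S\<close>, hence at
  \<open>A\<close>.\<close>

lemma zariski_closure_mult:
  fixes S :: "('k::field ^ 't::finite ^ 't) set"
  assumes S: "\<And>A B. A \<in> S \<Longrightarrow> B \<in> S \<Longrightarrow> A ** B \<in> S"
    and A: "A \<in> zariski_closure S" and B: "B \<in> zariski_closure S"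
  shows "A ** B \<in> zariski_closure S"
proof -
  have "meval (A ** B) p = 0" if p: "\<And>N. N \<in> S \<Longrightarrow> meval N p = 0" for p
  proof -
    have "meval (C ** B) p = 0" if C: "C \<in> S" for C
      using zariski_closureD[OF B, of "act C p"] S[OF C] p by (simp add: meval_act)
    then show ?thesis
      using zariski_closureD[OF A, of "subst_right B p"] by (simp add: meval_subst_right)
  qed
  then show ?thesis by (auto simp: zariski_closure_def)
qed

text \<open>\<open>f\<close> is a rational function without a pole at \<open>s\<^sub>0\<close>; its values are free at the zeros of
  the denominator.\<close>

definition rational_at :: "'k::field \<Rightarrow> ('k \<Rightarrow> 'k) \<Rightarrow> bool" where
  "rational_at s0 f \<longleftrightarrow> (\<exists>a b. poly b s0 \<noteq> 0 \<and> (\<forall>s. poly b s \<noteq> 0 \<longrightarrow> f s = poly a s / poly b s))"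

lemma rational_at_const [intro]: "rational_at s0 (\<lambda>_. c)"
  unfolding rational_at_def by (intro exI[of _ "[:c:]"] exI[of _ 1]) auto

lemma rational_at_id [intro]: "rational_at s0 (\<lambda>s. s)"
  unfolding rational_at_def by (intro exI[of _ "[:0, 1:]"] exI[of _ 1]) auto

lemma rational_at_add [intro]:
  assumes "rational_at s0 f" "rational_at s0 g" shows "rational_at s0 (\<lambda>s. f s + g s)"
proof -
  from assms obtain a b c d where "poly b s0 \<noteq> 0" "\<And>s. poly b s \<noteq> 0 \<Longrightarrow> f s = poly a s / poly b s"
     "poly d s0 \<noteq> 0" "\<And>s. poly d s \<noteq> 0 \<Longrightarrow> g s = poly c s / poly d s"
    unfolding rational_at_def by blast
  then show ?thesis unfolding rational_at_def
    by (intro exI[of _ "a * d + c * b"] exI[of _ "b * d"]) (auto simp: field_simps)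
qed

lemma rational_at_mult [intro]:
  assumes "rational_at s0 f" "rational_at s0 g" shows "rational_at s0 (\<lambda>s. f s * g s)"
proof -
  from assms obtain a b c d where "poly b s0 \<noteq> 0" "\<And>s. poly b s \<noteq> 0 \<Longrightarrow> f s = poly a s / poly b s"
     "poly d s0 \<noteq> 0" "\<And>s. poly d s \<noteq> 0 \<Longrightarrow> g s = poly c s / poly d s"
    unfolding rational_at_def by blast
  then show ?thesis unfolding rational_at_def
    by (intro exI[of _ "a * c"] exI[of _ "b * d"]) (auto simp: field_simps)
qed

lemma rational_at_divide [intro]:
  assumes "rational_at s0 f" "rational_at s0 g" "g s0 \<noteq> 0" shows "rational_at s0 (\<lambda>s. f s / g s)"
proof -
  from assms obtain a b c d where "poly b s0 \<noteq> 0" "\<And>s. poly b s \<noteq> 0 \<Longrightarrow> f s = poly a s / poly b s"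
     "poly d s0 \<noteq> 0" "\<And>s. poly d s \<noteq> 0 \<Longrightarrow> g s = poly c s / poly d s"
    unfolding rational_at_def by blast
  note ab = this
  \<comment> \<open>The additional factor \<open>d\<close> in the denominator excludes the zeros of
    \<open>d\<close>, where the value of \<open>g\<close> is unconstrained.\<close>
  have "f s / g s = poly (a * d) s / poly (b * c) s * (poly d s / poly d s)" if "poly (b * c * d) s \<noteq> 0" for s
    using ab(2)[of s] ab(4)[of s] that by simp
  moreover have "poly (b * c * d) s0 \<noteq> 0"
    using ab assms(3) by auto
  ultimately show ?thesis unfolding rational_at_def
    by (rule_tac x = "a * d * d" in exI, rule_tac x = "b * c * d" in exI) (simp add: mult.assoc)
qed

lemma rational_at_diff [intro]:
  assumes "rational_at s0 f" "rational_at s0 g" shows "rational_at s0 (\<lambda>s. f s - g s)"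
  using rational_at_add[OF assms(1) rational_at_mult[OF rational_at_const[of s0 "-1"] assms(2)]] by simp

lemma rational_at_sum [intro]:
  "(\<And>i. i \<in> A \<Longrightarrow> rational_at s0 (f i)) \<Longrightarrow> rational_at s0 (\<lambda>s. \<Sum>i\<in>A. f i s)"
  by (induction A rule: infinite_finite_induct) auto

lemma rational_at_prod [intro]:
  "(\<And>i. i \<in> A \<Longrightarrow> rational_at s0 (f i)) \<Longrightarrow> rational_at s0 (\<lambda>s. \<Prod>i\<in>A. f i s)"
  by (induction A rule: infinite_finite_induct) auto

lemma rational_at_power: "rational_at s0 f \<Longrightarrow> rational_at s0 (\<lambda>s. f s ^ n)"
  by (induction n) auto

lemma rational_at_finite_zeros:
  assumes "rational_at s0 f" "f s0 \<noteq> 0" shows "finite {s. f s = 0}"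
proof -
  from assms obtain a b where ab: "poly b s0 \<noteq> 0" "\<And>s. poly b s \<noteq> 0 \<Longrightarrow> f s = poly a s / poly b s"
    unfolding rational_at_def by blast
  have "poly (a * b) s0 \<noteq> 0" using ab assms(2) by auto
  then have "finite {s. poly (a * b) s = 0}"
    by (intro poly_roots_finite) auto
  then show ?thesis by (rule rev_finite_subset) (use ab in auto)
qed

definition curve_at :: "'k::field \<Rightarrow> ('k \<Rightarrow> 'k ^ 'n ^ 'm) \<Rightarrow> bool" where
  "curve_at s0 F \<longleftrightarrow> (\<forall>i j. rational_at s0 (\<lambda>s. F s $ i $ j))"

lemma curve_at_const [intro]: "curve_at s0 (\<lambda>_. A)"
  by (auto simp: curve_at_def)

lemma curve_at_add [intro]: "curve_at s0 F \<Longrightarrow> curve_at s0 G \<Longrightarrow> curve_at s0 (\<lambda>s. F s + G s)"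
  by (auto simp: curve_at_def)

lemma curve_at_diff [intro]: "curve_at s0 F \<Longrightarrow> curve_at s0 G \<Longrightarrow> curve_at s0 (\<lambda>s. F s - G s)"
  by (auto simp: curve_at_def)

lemma curve_at_mult [intro]: "curve_at s0 F \<Longrightarrow> curve_at s0 G \<Longrightarrow> curve_at s0 (\<lambda>s. F s ** G s)"
  unfolding curve_at_def matrix_matrix_mult_def vec_lambda_beta
  by (intro allI rational_at_sum rational_at_mult) auto

lemma curve_at_transpose [intro]: "curve_at s0 F \<Longrightarrow> curve_at s0 (\<lambda>s. transpose (F s))"
  by (auto simp: curve_at_def transpose_def)

lemma curve_at_mat: "rational_at s0 f \<Longrightarrow> curve_at s0 (\<lambda>s. mat (f s))"
proof -
  assume "rational_at s0 f"
  moreover have "(mat (f s)) $ i $ j = (if i = j then 1 else 0) * f s" for s i j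
    by (simp add: mat_def)
  ultimately show ?thesis
    unfolding curve_at_def \<open>\<And>s i j. mat (f s) $ i $ j = _\<close> by (intro allI rational_at_mult rational_at_const)
qed

lemma rational_at_det [intro]:
  "curve_at s0 F \<Longrightarrow> rational_at s0 (\<lambda>s. det (F s))"
  unfolding curve_at_def det_def by (intro rational_at_sum rational_at_mult rational_at_const rational_at_prod) auto

lemma curve_at_cramer_inv:
  assumes F: "curve_at s0 F" and "det (F s0) \<noteq> 0" shows "curve_at s0 (\<lambda>s. cramer_inv (F s))"
proof -
  have "rational_at s0 (\<lambda>s. if P then c else F s $ i $ l)" for P c i l
    using F by (cases P) (auto simp: curve_at_def)
  then have "curve_at s0 (\<lambda>s. (\<chi> i l. if l = k then (if i = j then 1 else 0) else F s $ i $ l))" for k j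
    unfolding curve_at_def by simp
  from rational_at_divide[OF rational_at_det[OF this] rational_at_det[OF F] assms(2)] show ?thesis
    unfolding curve_at_def cramer_inv_def by simp
qed

lemma curve_at_cayley:
  "curve_at s0 F \<Longrightarrow> det (mat 1 + F s0) \<noteq> 0 \<Longrightarrow> curve_at s0 (\<lambda>s. cayley (F s))"
  unfolding cayley_def by (intro curve_at_mult curve_at_cramer_inv curve_at_add curve_at_diff curve_at_const)

lemma rational_at_meval: "curve_at s0 F \<Longrightarrow> rational_at s0 (\<lambda>s. meval (F s) p)"
  unfolding meval_eq monom_val_def curve_at_def
  by (intro rational_at_sum rational_at_mult rational_at_const rational_at_prod rational_at_power)
     (auto split: prod.split)

text \<open>Infinitely many zeros force the rational function \<open>meval (F s) p\<close> to vanish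
  wherever it is regular, however far \<open>s0\<close> is from them: real parameters reach \<i>,
  rational ones reach any element of the field.\<close>

lemma zariski_closure_curve:
  assumes F: "curve_at s0 F" and inf: "infinite {s. F s \<in> zariski_closure S}"
  shows "F s0 \<in> zariski_closure S"
proof -
  have "meval (F s0) p = 0" if p: "\<And>N. N \<in> S \<Longrightarrow> meval N p = 0" for p
  proof (rule ccontr)
    assume "meval (F s0) p \<noteq> 0"
    then have "finite {s. meval (F s) p = 0}"
      by (rule rational_at_finite_zeros[OF rational_at_meval[OF F]])
    moreover have "{s. F s \<in> zariski_closure S} \<subseteq> {s. meval (F s) p = 0}"
      using zariski_closureD[OF _ p] by auto
    ultimately show False using inf finite_subset by blast
  qed
  then show ?thesis by (auto simp: zariski_closure_def)
qed

section \<open>Passing from rational parameters to arbitrary ones\<close>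

definition update_entry :: "'k ^ 'n ^ 'm \<Rightarrow> 'm \<Rightarrow> 'n \<Rightarrow> 'k \<Rightarrow> 'k ^ 'n ^ 'm" where
  "update_entry Z a b s = (\<chi> i j. if i = a \<and> j = b then s else Z $ i $ j)"

lemma curve_at_update_entry [intro]: "curve_at s0 (update_entry Z a b)"
  unfolding curve_at_def
proof (intro allI)
  fix i j show "rational_at s0 (\<lambda>s. update_entry Z a b s $ i $ j)"
    by (cases "i = a \<and> j = b") (auto simp: update_entry_def)
qed

lemma update_entry_same [simp]: "update_entry Z a b (Z $ a $ b) = Z"
  by (auto simp: update_entry_def vec_eq_iff)

text \<open>The entries are released one at a time. With the others fixed, \<open>F\<close> runs
  along a curve in the released entry, and \<open>d\<close> excludes only finitely many of the
  rational values. The set \<open>A\<close> of the induction contains all positions whose entry may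
  be irrational.\<close>

lemma rational_points_dense:
  fixes F :: "'k::field_char_0 ^ 'n::finite ^ 'm::finite \<Rightarrow> 'k ^ 't::finite ^ 't" and d :: "'k ^ 'n ^ 'm \<Rightarrow> 'k"
  assumes d: "\<And>Z a b. rational_at (Z $ a $ b) (\<lambda>s. d (update_entry Z a b s))"
    and F: "\<And>Z a b. d Z \<noteq> 0 \<Longrightarrow> curve_at (Z $ a $ b) (\<lambda>s. F (update_entry Z a b s))"
    and S: "\<And>Z. (\<And>a b. Z $ a $ b \<in> \<rat>) \<Longrightarrow> d Z \<noteq> 0 \<Longrightarrow> F Z \<in> zariski_closure S"
    and Z: "d Z \<noteq> 0"
  shows "F Z \<in> zariski_closure S"
proof -
  have "F Z \<in> zariski_closure S"
    if "finite A" "\<And>a b. (a, b) \<notin> A \<Longrightarrow> Z $ a $ b \<in> \<rat>" "d Z \<noteq> 0" for A Z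
    using that
  proof (induction A arbitrary: Z rule: finite_induct)
    case empty
    then show ?case using S by auto
  next
    case (insert v A)
    obtain a b where v: "v = (a, b)" by (cases v)
    let ?Z = "update_entry Z a b"
    have "F (?Z (Z $ a $ b)) \<in> zariski_closure S"
    proof (rule zariski_closure_curve[OF F[OF insert.prems(2)]])
      have "finite {s. d (?Z s) = 0}"
        by (rule rational_at_finite_zeros[OF d]) (simp add: insert.prems)
      moreover have "infinite (\<rat> :: 'k set)"
      proof -
        have "infinite (range (of_nat :: nat \<Rightarrow> 'k))" by (simp add: range_inj_infinite inj_of_nat)
        moreover have "range (of_nat :: nat \<Rightarrow> 'k) \<subseteq> \<rat>" by auto
        ultimately show ?thesis using finite_subset by blast
      qed
      ultimately have "infinite (\<rat> - {s. d (?Z s) = 0})" by simp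
      moreover have "\<rat> - {s. d (?Z s) = 0} \<subseteq> {s. F (?Z s) \<in> zariski_closure S}"
        using insert.IH insert.prems(1) v by (auto simp: update_entry_def)
      ultimately show "infinite {s. F (?Z s) \<in> zariski_closure S}" using finite_subset by blast
    qed
    then show ?case by simp
  qed
  from this[OF finite[of UNIV]] Z show ?thesis by auto
qed

section \<open>Rational points are dense\<close>

text \<open>Unlike the notation \<open>'a ^ 't ^ 't\<close>, this synonym adds no sort constraint to \<open>'t\<close>.\<close>

type_synonym ('a, 't) sq_matrix = "(('a, 't) vec, 't) vec"

section \<open>Matrices with rational entries\<close>

lemma map_matrix_mult:
  assumes "semiring_hom h"
  shows "map_matrix h (A ** B) = map_matrix h A ** map_matrix h (B :: 'a::comm_semiring_1 ^ 'n ^ 'm)"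
  by (simp add: vec_eq_iff matrix_matrix_mult_def semiring_hom_simps[OF assms] semiring_hom_sum[OF assms])

lemma map_matrix_transpose: "map_matrix h (transpose A) = transpose (map_matrix h A)"
  by (simp add: vec_eq_iff transpose_def)

lemma map_matrix_mat: "h 0 = 0 \<Longrightarrow> map_matrix h (mat c) = mat (h c)"
  by (simp add: vec_eq_iff mat_def)

lemma det_map_of_rat: "det (map_matrix of_rat A) = (of_rat (det A) :: 'k::field_char_0)"
  by (simp add: det_def of_rat_sum of_rat_mult of_rat_prod)

lemma map_of_rat_eq_iff: "map_matrix of_rat A = (map_matrix of_rat B :: 'k::field_char_0 ^ 'n ^ 'm) \<longleftrightarrow> A = B"
  by (simp add: vec_eq_iff)

lemma map_of_rat_Omega: "map_matrix of_rat Omega = (Omega :: ('k::field_char_0, 't::{finite,linorder}) sq_matrix)"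
  by (simp add: Omega_def Let_def vec_eq_iff of_rat_minus)

lemma map_of_rat_in_points_iff:
  "(map_matrix of_rat M :: ('k::field_char_0, 't::{finite,linorder}) sq_matrix) \<in> points G \<longleftrightarrow> M \<in> points G"
proof -
  note h = semiring_hom_of_rat[where 'k = 'k]
  have O: "Omega = (map_matrix of_rat Omega :: ('k, 't) sq_matrix)" and
    I: "mat 1 = (map_matrix of_rat (mat 1) :: ('k, 't) sq_matrix)"
    by (simp_all add: map_of_rat_Omega map_matrix_mat)
  have inv: "invertible (map_matrix of_rat M :: ('k, 't) sq_matrix) \<longleftrightarrow> invertible M"
    by (simp add: invertible_det_nz det_map_of_rat)
  show ?thesis
  proof (cases G)
    case Symplectic
    show ?thesis unfolding Symplectic points.simps mem_Collect_eq inv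
      by (subst (1 2) O) (simp only: map_matrix_transpose[symmetric] map_matrix_mult[OF h, symmetric] map_of_rat_eq_iff)
  next
    case Orthogonal
    show ?thesis unfolding Orthogonal points.simps mem_Collect_eq inv
      by (subst I) (simp only: map_matrix_transpose[symmetric] map_matrix_mult[OF h, symmetric] map_of_rat_eq_iff)
  qed (simp_all add: inv det_map_of_rat)
qed

text \<open>Taken as an image of the group over \<open>rat\<close>, so that the same rational matrix
  can be read in \<open>'k\<close> and in \<open>complex\<close>.\<close>

definition rational_points :: "classical_group \<Rightarrow> (('k::field_char_0, 't::{finite,linorder}) sq_matrix) set" where
  "rational_points G = map_matrix of_rat ` points G"

lemma rational_points_subset: "rational_points G \<subseteq> points G"
  by (auto simp: rational_points_def map_of_rat_in_points_iff)

definition rational_matrix :: "'k::field_char_0 ^ 'n ^ 'm \<Rightarrow> bool" where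
  "rational_matrix A \<longleftrightarrow> (\<forall>i j. A $ i $ j \<in> \<rat>)"

lemma rational_matrix_add: "rational_matrix A \<Longrightarrow> rational_matrix B \<Longrightarrow> rational_matrix (A + B)"
  and rational_matrix_diff: "rational_matrix A \<Longrightarrow> rational_matrix B \<Longrightarrow> rational_matrix (A - B)"
  and rational_matrix_transpose: "rational_matrix A \<Longrightarrow> rational_matrix (transpose A)"
  and rational_matrix_mat: "c \<in> \<rat> \<Longrightarrow> rational_matrix (mat c)"
  by (auto simp: rational_matrix_def transpose_def mat_def)

lemma rational_matrix_mult:
  "rational_matrix (A :: 'k::field_char_0 ^ 'n ^ 'm) \<Longrightarrow> rational_matrix (B :: 'k ^ 'l ^ 'n) \<Longrightarrow> rational_matrix (A ** B)"
  by (auto simp: rational_matrix_def matrix_matrix_mult_def)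

lemma det_rational: "rational_matrix A \<Longrightarrow> det A \<in> \<rat>"
  unfolding rational_matrix_def det_def by (intro Rats_sum Rats_mult Rats_prod) auto

lemma rational_matrix_cramer_inv:
  assumes "rational_matrix A" shows "rational_matrix (cramer_inv A)"
proof -
  have "rational_matrix (\<chi> i l. if l = k then (if i = j then 1 else 0) else A $ i $ l)" for k j
    using assms by (auto simp: rational_matrix_def)
  from det_rational[OF this] det_rational[OF assms] show ?thesis
    by (auto simp: rational_matrix_def cramer_inv_def)
qed

lemma rational_matrix_cayley: "rational_matrix A \<Longrightarrow> rational_matrix (cayley A)"
  unfolding cayley_def
  by (intro rational_matrix_mult rational_matrix_cramer_inv rational_matrix_add rational_matrix_diff
      rational_matrix_mat) auto

lemma rational_pointsI:
  assumes "M \<in> points G" "rational_matrix M"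
  shows "M \<in> rational_points G"
proof -
  have "\<forall>i j. \<exists>q. M $ i $ j = of_rat q"
    using assms(2) by (auto simp: rational_matrix_def Rats_def)
  then obtain q where "\<And>i j. M $ i $ j = of_rat (q i j)" by metis
  then have "M = map_matrix of_rat (\<chi> i j. q i j)" by (simp add: vec_eq_iff)
  then show ?thesis using assms(1) by (auto simp: rational_points_def map_of_rat_in_points_iff)
qed

lemma invertible_mult_closed:
  "invertible A \<Longrightarrow> invertible B \<Longrightarrow> invertible (A ** B)" for A B :: "('k::field, 'n::finite) sq_matrix"
  unfolding invertible_det_nz by (simp add: det_mul)

lemma points_mult:
  assumes "A \<in> points G" "B \<in> points G" shows "A ** B \<in> points G"
proof -
  have "transpose (A ** B) ** J ** (A ** B) = J"
    if "transpose A ** J ** A = J" "transpose B ** J ** B = J" for J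
  proof -
    have "transpose (A ** B) ** J ** (A ** B) = transpose B ** (transpose A ** J ** A) ** B"
      by (simp add: matrix_transpose_mul matrix_mul_assoc)
    then show ?thesis using that by simp
  qed
  from this[of "mat 1"] this[of Omega] show ?thesis
    using assms by (cases G) (auto simp: invertible_mult_closed det_mul)
qed

lemma rational_points_mult:
  "A \<in> rational_points G \<Longrightarrow> B \<in> rational_points G \<Longrightarrow> A ** B \<in> rational_points G"
  unfolding rational_points_def
  by (auto simp flip: map_matrix_mult[OF semiring_hom_of_rat] intro: points_mult)

text \<open>A retraction of the general linear group onto the special linear group.\<close>

definition scale_row :: "('k::field, 't::{finite,linorder}) sq_matrix \<Rightarrow> ('k, 't) sq_matrix" where
  "scale_row A = (\<chi> i. if i = Min UNIV then (1 / det A) *s A $ i else A $ i)"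

lemma scale_row_nth: "scale_row A $ i $ j = (if i = Min UNIV then A $ i $ j / det A else A $ i $ j)"
  by (simp add: scale_row_def)

lemma det_scale_row: "det A \<noteq> 0 \<Longrightarrow> det (scale_row A) = 1"
proof -
  assume "det A \<noteq> 0"
  have "det (scale_row A) = 1 / det A * det (\<chi> i. if i = Min UNIV then A $ i else A $ i)"
    unfolding scale_row_def by (rule det_row_mul)
  then show ?thesis using \<open>det A \<noteq> 0\<close> by simp
qed

lemma scale_row_id: "det A = 1 \<Longrightarrow> scale_row A = A"
  by (simp add: vec_eq_iff scale_row_nth)

lemma curve_at_scale_row:
  assumes "curve_at s0 F" "det (F s0) \<noteq> 0" shows "curve_at s0 (\<lambda>s. scale_row (F s))"
  unfolding curve_at_def
proof (intro allI)
  fix i j show "rational_at s0 (\<lambda>s. scale_row (F s) $ i $ j)"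
    using assms rational_at_det[OF assms(1)]
    by (cases "i = Min UNIV") (auto simp: scale_row_nth curve_at_def)
qed

lemma rational_matrix_scale_row: "rational_matrix A \<Longrightarrow> rational_matrix (scale_row A)"
  using det_rational[of A] by (auto simp: rational_matrix_def scale_row_nth)

lemma GL_dense: "points General_Linear \<subseteq> zariski_closure (rational_points General_Linear)"
proof
  fix M :: "('k::field_char_0, 't::{finite,linorder}) sq_matrix"
  assume "M \<in> points General_Linear"
  then have M: "det M \<noteq> 0" by (simp add: invertible_det_nz)
  show "M \<in> zariski_closure (rational_points General_Linear)"
  proof (rule rational_points_dense[where F = "\<lambda>A. A" and d = det, OF _ _ _ M])
    fix Z :: "('k, 't) sq_matrix" assume "\<And>a b. Z $ a $ b \<in> \<rat>" "det Z \<noteq> 0"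
    then have "Z \<in> rational_points General_Linear"
      by (intro rational_pointsI) (auto simp: invertible_det_nz rational_matrix_def)
    then show "Z \<in> zariski_closure (rational_points General_Linear)"
      using zariski_closure_superset by blast
  qed auto
qed

text \<open>The entries of a matrix of determinant one cannot be varied independently, so invertible
  matrices serve as parameters and \<open>scale_row\<close> maps them into the group while fixing
  \<open>M\<close>.\<close>

lemma SL_dense: "points Special_Linear \<subseteq> zariski_closure (rational_points Special_Linear)"
proof
  fix M :: "('k::field_char_0, 't::{finite,linorder}) sq_matrix"
  assume "M \<in> points Special_Linear"
  then have M: "det M \<noteq> 0" "scale_row M = M" by (auto simp: scale_row_id)
  have "scale_row M \<in> zariski_closure (rational_points Special_Linear)"
  proof (rule rational_points_dense[where F = scale_row and d = det, OF _ _ _ M(1)])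
    fix Z :: "('k, 't) sq_matrix" assume "\<And>a b. Z $ a $ b \<in> \<rat>" "det Z \<noteq> 0"
    then have "scale_row Z \<in> rational_points Special_Linear"
      by (intro rational_pointsI rational_matrix_scale_row)
         (auto simp: invertible_det_nz rational_matrix_def det_scale_row)
    then show "scale_row Z \<in> zariski_closure (rational_points Special_Linear)"
      using zariski_closure_superset by blast
  qed (auto intro!: curve_at_scale_row)
  then show "M \<in> zariski_closure (rational_points Special_Linear)" by (simp add: M)
qed

subsection \<open>Isometry groups of bilinear forms\<close>

definition isometries :: "('k::field, 't::finite) sq_matrix \<Rightarrow> (('k, 't) sq_matrix) set" where
  "isometries J = {M. transpose M ** J ** M = J}"

lemma isometries_mult: "A \<in> isometries J \<Longrightarrow> B \<in> isometries J \<Longrightarrow> A ** B \<in> isometries J"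
proof -
  assume "A \<in> isometries J" "B \<in> isometries J"
  moreover have "transpose (A ** B) ** J ** (A ** B) = transpose B ** (transpose A ** J ** A) ** B"
    by (simp add: matrix_transpose_mul matrix_mul_assoc)
  ultimately show ?thesis by (simp add: isometries_def)
qed

lemma isometries_invertible:
  fixes J :: "('k::field, 't::finite) sq_matrix"
  assumes "det J \<noteq> 0" "M \<in> isometries J" shows "invertible M"
proof -
  have "det (transpose M ** J ** M) \<noteq> 0" using assms by (simp add: isometries_def)
  then show ?thesis by (auto simp: invertible_det_nz det_mul)
qed

definition bilin :: "('k::field, 't::finite) sq_matrix \<Rightarrow> 'k ^ 't \<Rightarrow> 'k ^ 't \<Rightarrow> 'k" where
  "bilin J x y = (\<Sum>i\<in>UNIV. x $ i * (J *v y) $ i)"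

lemma bilin_simps:
  "bilin J (x + x') y = bilin J x y + bilin J x' y" "bilin J x (y + y') = bilin J x y + bilin J x y'"
  "bilin J (- x) y = - bilin J x y" "bilin J x (- y) = - bilin J x y"
  "bilin J (c *s x) y = c * bilin J x y" "bilin J 0 y = 0"
  by (simp_all add: bilin_def distrib_right distrib_left sum.distrib matrix_vector_right_distrib
      sum_negf sum_distrib_left mult.assoc matrix_vector_mult_def)

lemma matrix_vector_mult_axis: "(A *v axis j 1) $ i = A $ i $ j" for A :: "'k::semiring_1 ^ 'n ^ 'm"
  by (simp add: matrix_vector_mult_def axis_def if_distrib cong: if_cong)

lemma bilin_axis: "bilin J (axis i 1) x = (J *v x) $ i"
  by (simp add: bilin_def axis_def if_distrib if_distribR cong: if_cong)

lemma bilin_mult: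
  fixes J M :: "('k::field, 't::finite) sq_matrix"
  shows "bilin J (M *v x) (M *v y) = bilin (transpose M ** J ** M) x y"
proof -
  have "bilin J (M *v x) z = bilin (transpose M ** J) x z" for z
  proof -
    have "bilin J (M *v x) z = (\<Sum>i\<in>UNIV. \<Sum>j\<in>UNIV. M $ i $ j * x $ j * (J *v z) $ i)"
      by (simp add: bilin_def matrix_vector_mult_def[of M] sum_distrib_right)
    also have "\<dots> = (\<Sum>j\<in>UNIV. \<Sum>i\<in>UNIV. M $ i $ j * x $ j * (J *v z) $ i)"
      by (rule sum.swap)
    also have "\<dots> = (\<Sum>j\<in>UNIV. x $ j * (transpose M *v (J *v z)) $ j)"
      unfolding matrix_vector_mult_def[of "transpose M"] by (simp add: transpose_def sum_distrib_left mult_ac)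
    finally show ?thesis by (simp add: bilin_def matrix_vector_mul_assoc)
  qed
  from this[of "M *v y"] show ?thesis
    by (simp add: bilin_def matrix_vector_mul_assoc matrix_mul_assoc)
qed

lemma bilin_isometry: "M \<in> isometries J \<Longrightarrow> bilin J (M *v x) (M *v y) = bilin J x y"
  by (simp add: bilin_mult isometries_def)

text \<open>The map \<open>x \<mapsto> x + c B(e\<^sub>i, x) e\<^sub>i\<close>: a transvection or, for suitable \<open>c\<close>, a reflection.\<close>

definition elementary :: "('k::field, 't::finite) sq_matrix \<Rightarrow> 'k \<Rightarrow> 't \<Rightarrow> ('k, 't) sq_matrix" where
  "elementary J c i = mat 1 + (\<chi> a b. if a = i then c * J $ i $ b else 0)"

lemma elementary_apply: "elementary J c i *v x = x + (c * (J *v x) $ i) *s axis i 1"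
  by (simp add: elementary_def matrix_vector_mult_add_rdistrib)
     (simp add: vec_eq_iff matrix_vector_mult_def axis_def sum_distrib_left mult.assoc)

text \<open>The line of the axis \<open>i\<close> is mapped into itself. A zero parameter on the
  right describes inverses: \<open>- c\<close> for a transvection (diagonal entry 0), while the
  reflection \<open>c = -2\<close> (diagonal entry 1) is its own inverse.\<close>

lemma elementary_mult:
  "elementary J c i ** elementary J d i = elementary J (c + d + c * d * J $ i $ i) i"
  unfolding matrix_eq matrix_vector_mul_assoc[symmetric] elementary_apply
  by (simp add: vec_eq_iff matrix_vector_right_distrib vector_scalar_commute matrix_vector_mult_axis
      algebra_simps)

lemma elementary_0: "elementary J 0 i = mat 1"
  by (simp add: elementary_def vec_eq_iff)

lemma rational_matrix_elementary:
  "rational_matrix J \<Longrightarrow> c \<in> \<rat> \<Longrightarrow> rational_matrix (elementary J c i)"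
  unfolding elementary_def
  by (intro rational_matrix_add rational_matrix_mat) (auto simp: rational_matrix_def)

lemma matrix_eq_bilin: "(\<And>x y. bilin K x y = bilin J x y) \<Longrightarrow> K = J"
proof -
  assume *: "\<And>x y. bilin K x y = bilin J x y"
  have "K *v x = J *v x" for x
    using *[of "axis _ 1" x] by (simp add: vec_eq_iff bilin_axis)
  then show ?thesis by (simp add: matrix_eq)
qed

text \<open>The quadratic expression in \<open>c\<close> is the coefficient of the error term in the
  expanded form. For \<open>e = 1\<close> and diagonal entry 1 its nonzero root is -2, a reflection;
  for \<open>e = -1\<close> and diagonal entry 0 every \<open>c\<close> is a root, giving
  transvections.\<close>

lemma elementary_isometry:
  assumes J: "transpose J = mat e ** J" and c: "c * e + c + c * c * J $ i $ i = 0"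
  shows "elementary J c i \<in> isometries J"
proof -
  have r: "bilin J x (b *s axis i 1) = b * e * (J *v x) $ i" for x b
  proof -
    have "J $ a $ i = e * J $ i $ a" for a
    proof -
      have "transpose J $ i $ a = (mat e ** J) $ i $ a" by (simp add: J)
      then show ?thesis by (simp add: transpose_def mat_mult_nth)
    qed
    then have "(J *v axis i 1) $ a = e * J $ i $ a" for a
      by (simp add: matrix_vector_mult_axis)
    then show ?thesis
      by (simp add: bilin_def vector_scalar_commute matrix_vector_mult_def[of J x] sum_distrib_left mult_ac)
  qed
  have ii: "e * J $ i $ i = J $ i $ i"
  proof -
    have "transpose J $ i $ i = (mat e ** J) $ i $ i" by (simp add: J)
    then show ?thesis by (simp add: transpose_def mat_mult_nth)
  qed
  have "bilin J (elementary J c i *v x) (elementary J c i *v y) = bilin J x y" for x y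
  proof -
    let ?u = "(J *v x) $ i" and ?v = "(J *v y) $ i"
    have "bilin J (elementary J c i *v x) (elementary J c i *v y)
       = bilin J x y + (c * ?v) * e * ?u + (c * ?u) * (?v + (c * ?v) * (e * J $ i $ i))"
      unfolding elementary_apply bilin_simps r
      by (simp add: bilin_axis matrix_vector_mult_axis vector_scalar_commute algebra_simps)
    also have "\<dots> = bilin J x y + (c * e + c + c * c * J $ i $ i) * ?u * ?v"
      unfolding ii by (simp add: algebra_simps)
    finally show ?thesis using c by simp
  qed
  then show ?thesis
    unfolding isometries_def mem_Collect_eq bilin_mult by (intro matrix_eq_bilin)
qed

text \<open>
  If \<open>x\<^sub>0\<close> lies in the kernel of \<open>1 + M\<close> and \<open>B(e\<^sub>i, x\<^sub>0) \<noteq> 0\<close>, then \<open>M e\<^sub>i\<close> is not in the image of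
  \<open>1 + M\<close>; hence the kernel of \<open>1 + M g\<close>, for \<open>g\<close> elementary along \<open>e\<^sub>i\<close>, is strictly smaller than that
  of \<open>1 + M\<close>.
\<close>

lemma isometries_reduction:
  fixes J :: "('k::field, 't::finite) sq_matrix"
  assumes detJ: "det J \<noteq> 0"
    and gen: "\<And>i. \<exists>c g'. c \<noteq> 0 \<and> g' \<in> H \<and> elementary J c i ** g' = mat 1 \<and> elementary J c i \<in> isometries J"
    and H: "\<And>A B. A \<in> H \<Longrightarrow> B \<in> H \<Longrightarrow> A ** B \<in> H"
    and base: "\<And>M. M \<in> isometries J \<Longrightarrow> det (mat 1 + M) \<noteq> 0 \<Longrightarrow> M \<in> H"
    and M: "M \<in> isometries J"
  shows "M \<in> H"
  using M
proof (induction "vec.dim {x. (mat 1 + M) *v x = 0}" arbitrary: M rule: less_induct)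
  case less
  let ?K = "\<lambda>M :: ('k, 't) sq_matrix. {x. (mat 1 + M) *v x = 0}"
  show ?case
  proof (cases "det (mat 1 + M) = 0")
    case False
    then show ?thesis using base less.prems by blast
  next
    case True
    then have "\<not> invertible (mat 1 + M)" by (simp add: invertible_det_nz)
    then obtain x0 where x0: "(mat 1 + M) *v x0 = 0" "x0 \<noteq> 0"
      unfolding invertible_left_inverse matrix_left_invertible_ker by blast
    have "invertible J" using detJ by (simp add: invertible_det_nz)
    then have "J *v x0 \<noteq> 0"
      using x0(2) unfolding invertible_left_inverse matrix_left_invertible_ker by blast
    then obtain i where i: "(J *v x0) $ i \<noteq> 0" by (auto simp: vec_eq_iff)
    obtain c g' where c: "c \<noteq> 0" and g': "g' \<in> H" "elementary J c i ** g' = mat 1"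
      and g: "elementary J c i \<in> isometries J"
      using gen by blast
    let ?v = "axis i 1 :: 'k ^ 't"
    let ?M = "M ** elementary J c i"
    have M': "?M \<in> isometries J" using isometries_mult less.prems g by blast
    have Mx0: "M *v x0 = - x0"
      using x0(1) by (simp add: matrix_vector_mult_add_rdistrib eq_neg_iff_add_eq_0 add.commute)
    have key: "(mat 1 + M) *v x = 0 \<and> (J *v x) $ i = 0" if x: "x \<in> ?K ?M" for x
    proof -
      let ?b = "c * (J *v x) $ i"
      have "x + (M *v x + ?b *s (M *v ?v)) = 0"
        using x by (simp add: matrix_vector_mult_add_rdistrib matrix_vector_mul_assoc[symmetric]
            elementary_apply matrix_vector_right_distrib vector_scalar_commute)
      then have e: "x + M *v x = - (?b *s (M *v ?v))"
        by (simp add: add.assoc[symmetric] eq_neg_iff_add_eq_0)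
      \<comment> \<open>Since \<open>M *v x0 = - x0\<close>, invariance of the form gives B(Mx, x0)
        = - B(x, x0): the image of 1 + M pairs to zero with \<open>x0\<close>, whereas
        \<open>M *v ?v\<close> does not.\<close>
      have 1: "bilin J (x + M *v x) x0 = 0"
        using bilin_isometry[OF less.prems, of x x0]
        by (simp add: Mx0 bilin_simps) (simp add: eq_commute[of "- _"])
      have 2: "bilin J (M *v ?v) x0 = - (J *v x0) $ i"
        using bilin_isometry[OF less.prems, of ?v x0] by (simp add: Mx0 bilin_simps bilin_axis minus_equation_iff)
      have "?b * (J *v x0) $ i = 0"
        using 1 unfolding e bilin_simps 2 by simp
      then have b: "?b = 0" using i by simp
      then show ?thesis
        using e c by (simp add: matrix_vector_mult_add_rdistrib)
    qed
    have "?K ?M \<subset> ?K M"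
      using key i x0(1) by blast
    moreover have "vec.subspace (?K A)" for A
      by (auto simp: vec.subspace_def matrix_vector_right_distrib vector_scalar_commute)
    ultimately have "vec.dim (?K ?M) < vec.dim (?K M)"
      by (intro vec.dim_psubset) (simp add: vec.span_eq_iff[THEN iffD2])
    from less.hyps[OF this M'] have "?M \<in> H" .
    then have "?M ** g' \<in> H" using g'(1) H by blast
    then show ?thesis by (simp add: matrix_mul_assoc[symmetric] g'(2))
  qed
qed

text \<open>\<open>M\<close> is the Cayley transform of an element of the Lie algebra of
  \<open>J\<close>. That linear space is the image of all matrices under the projection
  \<open>pr\<close>, whose coefficients are rational, so the entries of the argument of
  \<open>pr\<close> are free parameters. The determinant condition is removed later by
  \<open>isometries_reduction\<close>.\<close>

lemma isometries_dense:
  fixes J :: "('k::field_char_0, 't::finite) sq_matrix"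
  assumes detJ: "det J \<noteq> 0" and J: "transpose J = mat e ** J" and ratJ: "rational_matrix J"
    and S: "\<And>M. M \<in> isometries J \<Longrightarrow> rational_matrix M \<Longrightarrow> M \<in> S"
    and M: "M \<in> isometries J" "det (mat 1 + M) \<noteq> 0"
  shows "M \<in> zariski_closure S"
proof -
  let ?C = "cramer_inv J"
  \<comment> \<open>the projection onto the Lie algebra along the self-adjoint matrices\<close>
  define pr where "pr Z = mat (1/2) ** (Z - ?C ** transpose Z ** J)" for Z :: "('k, 't) sq_matrix"
  have half: "mat (1/2) ** (A + A) = A" for A :: "('k, 't) sq_matrix"
    by (simp add: vec_eq_iff mat_mult_nth)
  have C1: "J ** ?C = mat 1" and C2: "?C ** J = mat 1" using cramer_inv[OF detJ] by auto
  \<comment> \<open>The inverse of the form inherits its symmetry sign, which makes the adjoint map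
    \<open>Z \<mapsto> ?C ** transpose Z ** J\<close> an involution; \<open>pr\<close> is half of
    the difference between \<open>Z\<close> and its adjoint.\<close>
  have "mat e ** J ** transpose ?C = mat 1"
    using arg_cong[OF C2, of transpose] by (simp add: matrix_transpose_mul J)
  then have "J ** (mat e ** transpose ?C) = mat 1"
    by (simp add: matrix_mul_assoc mat_mult_commute[of J])
  then have "?C ** (J ** (mat e ** transpose ?C)) = ?C" by simp
  then have C3: "mat e ** transpose ?C = ?C"
    by (simp add: matrix_mul_assoc C2)
  have pr_skew: "transpose (pr Z) ** J = - (J ** pr Z)" for Z
  proof -
    have "transpose (?C ** transpose Z ** J) ** J = mat e ** J ** Z ** transpose ?C ** J"
      by (simp add: matrix_transpose_mul J matrix_mul_assoc)
    also have "\<dots> = J ** Z ** (mat e ** transpose ?C) ** J"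
      using mat_mult_commute[of "J ** Z" e] by (simp add: matrix_mul_assoc)
    also have "\<dots> = J ** Z"
      by (simp add: C3 matrix_mul_assoc[symmetric] C2)
    finally have 1: "transpose (Z - ?C ** transpose Z ** J) ** J = transpose Z ** J - J ** Z"
      by (simp add: transpose_diff matrix_ring)
    have 2: "J ** (Z - ?C ** transpose Z ** J) = J ** Z - transpose Z ** J"
      by (simp add: matrix_ring C1)
    have "transpose (pr Z) ** J = mat (1/2) ** (transpose (Z - ?C ** transpose Z ** J) ** J)"
      by (simp add: pr_def matrix_transpose_mul mat_mult_commute[of "transpose _"] matrix_mul_assoc)
    also have "\<dots> = - (mat (1/2) ** (J ** (Z - ?C ** transpose Z ** J)))"
      unfolding 1 2 by (simp add: matrix_neg_right[symmetric])
    also have "\<dots> = - (J ** pr Z)"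
      by (simp add: pr_def matrix_mul_assoc mat_mult_commute[of J])
    finally show ?thesis .
  qed
  have pr_id: "pr X = X" if "transpose X ** J = - (J ** X)" for X
  proof -
    have "?C ** transpose X ** J = - X"
      using that by (simp add: matrix_mul_assoc[symmetric] matrix_neg_right) (simp add: matrix_mul_assoc C2)
    then show ?thesis by (simp only: pr_def diff_minus_eq_add half)
  qed
  have cont: "curve_at s0 (\<lambda>s. pr (update_entry Z a b s))" for s0 Z a b
    unfolding pr_def by (intro curve_at_mult curve_at_diff curve_at_transpose curve_at_const curve_at_update_entry)
  define X where "X = cayley M"
  have X: "transpose X ** J = - (J ** X)"
    unfolding X_def using M by (intro cayley_skew) (auto simp: isometries_def)
  have d: "det (mat 1 + pr X) \<noteq> 0" and cX: "cayley (pr X) = M"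
    using cayley_cayley[OF M(2)] unfolding pr_id[OF X] by (auto simp: X_def)
  have "cayley (pr X) \<in> zariski_closure S"
  proof (rule rational_points_dense[where F = "\<lambda>Z. cayley (pr Z)" and d = "\<lambda>Z. det (mat 1 + pr Z)", OF _ _ _ d])
    fix Z a b
    show "rational_at (Z $ a $ b) (\<lambda>s. det (mat 1 + pr (update_entry Z a b s)))"
      by (intro rational_at_det curve_at_add curve_at_const cont)
    show "curve_at (Z $ a $ b) (\<lambda>s. cayley (pr (update_entry Z a b s)))" if "det (mat 1 + pr Z) \<noteq> 0"
      using that by (intro curve_at_cayley cont) simp
  next
    fix Z assume Z: "\<And>a b. Z $ a $ b \<in> \<rat>" and dZ: "det (mat 1 + pr Z) \<noteq> 0"
    have "rational_matrix (pr Z)"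
      unfolding pr_def using Z ratJ
      by (intro rational_matrix_mult rational_matrix_diff rational_matrix_transpose rational_matrix_mat
          rational_matrix_cramer_inv) (auto simp: rational_matrix_def)
    then have "cayley (pr Z) \<in> S"
      using cayley_form_transpose[OF dZ pr_skew]
      by (intro S rational_matrix_cayley) (auto simp: isometries_def)
    then show "cayley (pr Z) \<in> zariski_closure S" using zariski_closure_superset by blast
  qed
  then show ?thesis by (simp add: cX)
qed

subsection \<open>The standard symplectic form\<close>

lemma row_index_less: "row_index (i :: 't::{finite,linorder}) < CARD('t)"
  unfolding row_index_def by (rule psubset_card_mono) auto

lemma row_index_strict_mono: "i < j \<Longrightarrow> row_index i < row_index (j :: 't::{finite,linorder})"
  unfolding row_index_def by (intro psubset_card_mono) auto

lemma row_index_inj: "row_index i = row_index j \<longleftrightarrow> i = (j :: 't::{finite,linorder})"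
  using row_index_strict_mono[of i j] row_index_strict_mono[of j i] by (cases i j rule: linorder_cases) auto

lemma row_index_surj:
  assumes "n < CARD('t::{finite,linorder})" shows "\<exists>i :: 't. row_index i = n"
proof -
  have "range (row_index :: 't \<Rightarrow> nat) = {..<CARD('t)}"
    by (rule card_subset_eq) (auto simp: row_index_less card_image inj_def row_index_inj)
  then show ?thesis using assms by (metis imageE lessThan_iff)
qed

lemma Omega_transpose:
  assumes "even CARD('t)"
  shows "transpose Omega = mat (-1) ** (Omega :: ('k::field, 't::{finite,linorder}) sq_matrix)"
  using assms by (auto elim!: evenE simp: vec_eq_iff mat_mult_nth transpose_def Omega_def Let_def)

lemma Omega_diag:
  assumes "even CARD('t)" shows "(Omega :: ('k::field, 't::{finite,linorder}) sq_matrix) $ i $ i = 0"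
  using assms row_index_less[of i] by (auto simp: Omega_def Let_def elim!: evenE)

lemma Omega_square:
  assumes "even CARD('t)"
  shows "Omega ** Omega = (mat (-1) :: ('k::field, 't::{finite,linorder}) sq_matrix)"
proof -
  define s where "s = CARD('t) div 2"
  have t: "CARD('t) = s + s" using assms by (auto simp: s_def)
  define sg where "sg i = (if row_index i < s then 1 else -1 :: 'k)" for i :: 't
  have "\<exists>j :: 't. row_index j = (if row_index i < s then row_index i + s else row_index i - s)" for i :: 't
    using row_index_less[of i] t by (intro row_index_surj) auto
  then obtain p :: "'t \<Rightarrow> 't" where
    p: "\<And>i. row_index (p i) = (if row_index i < s then row_index i + s else row_index i - s)"
    by metis
  \<comment> \<open>\<open>Omega\<close> is a signed permutation matrix: \<open>p\<close> exchanges
    rows that are \<open>s\<close> places apart, and \<open>sg i\<close> is the only nonzero entry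
    of row \<open>i\<close>.\<close>
  have Om: "(Omega :: ('k, 't) sq_matrix) $ i $ j = (if j = p i then sg i else 0)" for i j
    using row_index_less[of i] row_index_less[of j] t
    unfolding Omega_def Let_def s_def[symmetric] row_index_inj[symmetric, of j] p sg_def
    by auto
  have pp: "p (p i) = i" for i
    using row_index_less[of i] t unfolding row_index_inj[symmetric, of "p (p i)"] p by auto
  have sp: "sg i * sg (p i) = -1" for i
    using row_index_less[of i] t by (auto simp: sg_def p)
  have "((Omega :: ('k, 't) sq_matrix) ** Omega) $ i $ j = (if i = j then -1 else 0)" for i j
  proof -
    have "((Omega :: ('k, 't) sq_matrix) ** Omega) $ i $ j
        = (\<Sum>k\<in>UNIV. if k = p i then sg i * (if j = p (p i) then sg (p i) else 0) else 0)"
      unfolding matrix_matrix_mult_def vec_lambda_beta Om by (intro sum.cong) auto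
    then show ?thesis by (auto simp: pp sp)
  qed
  then show ?thesis by (simp add: vec_eq_iff mat_def)
qed

lemma det_Omega_nz:
  assumes "even CARD('t)" shows "det (Omega :: ('k::field, 't::{finite,linorder}) sq_matrix) \<noteq> 0"
proof -
  have "Omega ** (mat (-1) ** Omega) = (mat 1 :: ('k, 't) sq_matrix)"
    by (simp add: matrix_mul_assoc mat_mult_commute[of Omega])
       (simp add: matrix_mul_assoc[symmetric] Omega_square[OF assms] mat_mult_mat)
  then show ?thesis by (rule det_nz_if_right_inverse)
qed

lemma rational_matrix_Omega: "rational_matrix Omega"
  by (auto simp: rational_matrix_def Omega_def Let_def)

lemma points_Orthogonal: "points Orthogonal = isometries (mat 1)"
  using isometries_invertible[of "mat 1"] by (auto simp: isometries_def)

lemma points_Symplectic: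
  "even CARD('t) \<Longrightarrow> points Symplectic = isometries (Omega :: ('k::field, 't::{finite,linorder}) sq_matrix)"
  using isometries_invertible[of "Omega :: ('k, 't) sq_matrix"] det_Omega_nz[where 'k = 'k and 't = 't]
  by (auto simp: isometries_def)

theorem rational_points_zariski_dense:
  assumes "G = Symplectic \<Longrightarrow> even CARD('t)"
  shows "points G \<subseteq> zariski_closure (rational_points G :: (('k::field_char_0, 't::{finite,linorder}) sq_matrix) set)"
proof (cases G)
  case General_Linear
  then show ?thesis by (simp add: GL_dense del: points.simps)
next
  case Special_Linear
  then show ?thesis by (simp add: SL_dense del: points.simps)
next
  case Orthogonal
  let ?H = "zariski_closure (rational_points Orthogonal :: (('k, 't) sq_matrix) set)"
  have I: "rational_matrix (mat 1 :: ('k, 't) sq_matrix)" by (intro rational_matrix_mat) auto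
  have I1: "(mat 1 :: ('k, 't) sq_matrix) $ i $ i = 1" for i by (simp add: mat_def)
  \<comment> \<open>This is the reflection that negates coordinate \<open>i\<close>. Reflections
    give access to the matrices of determinant -1, all of which have eigenvalue -1 and so escape the
    Cayley transform.\<close>
  have el: "elementary (mat 1) (-2) i \<in> isometries (mat 1 :: ('k, 't) sq_matrix)" for i
    by (rule elementary_isometry[where e = 1]) (simp_all add: I1)
  have S: "M \<in> rational_points Orthogonal" if "M \<in> isometries (mat 1)" "rational_matrix M" for M :: "('k, 't) sq_matrix"
    by (rule rational_pointsI) (use that in \<open>simp_all add: points_Orthogonal del: points.simps\<close>)
  have "M \<in> ?H" if "M \<in> isometries (mat 1)" for M
  proof (rule isometries_reduction[where J = "mat 1" and H = ?H])
    fix i :: 't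
    have "elementary (mat 1) (-2) i \<in> ?H"
      by (intro subsetD[OF zariski_closure_superset] S el rational_matrix_elementary I) auto
    moreover have "elementary (mat 1) (-2) i ** elementary (mat 1) (-2) i = (mat 1 :: ('k, 't) sq_matrix)"
      unfolding elementary_mult by (simp add: elementary_0 I1)
    ultimately show "\<exists>c g'. c \<noteq> 0 \<and> g' \<in> ?H \<and> elementary (mat 1) c i ** g' = mat 1
        \<and> elementary (mat 1) c i \<in> isometries (mat 1)"
      using el by (intro exI[of _ "-2"] exI[of _ "elementary (mat 1) (-2) i"]) auto
  next
    fix M :: "('k, 't) sq_matrix" assume "M \<in> isometries (mat 1)" "det (mat 1 + M) \<noteq> 0"
    then show "M \<in> ?H" using S I by (intro isometries_dense[of "mat 1" 1]) auto
  qed (auto intro: zariski_closure_mult rational_points_mult that)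
  then show ?thesis by (auto simp: Orthogonal points_Orthogonal simp del: points.simps)
next
  case Symplectic
  have ev: "even CARD('t)" using assms Symplectic by simp
  let ?O = "Omega :: ('k, 't) sq_matrix"
  let ?H = "zariski_closure (rational_points Symplectic :: (('k, 't) sq_matrix) set)"
  have el: "elementary ?O c i \<in> isometries ?O" for c i
    by (rule elementary_isometry[where e = "-1"]) (auto simp: Omega_transpose[OF ev] Omega_diag[OF ev])
  have S: "M \<in> rational_points Symplectic" if "M \<in> isometries ?O" "rational_matrix M" for M
    by (rule rational_pointsI) (use that in \<open>simp_all add: points_Symplectic[OF ev] del: points.simps\<close>)
  have "M \<in> ?H" if "M \<in> isometries ?O" for M
  proof (rule isometries_reduction[where J = ?O and H = ?H])
    fix i :: 't
    have "elementary ?O (-1) i \<in> ?H"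
      by (intro subsetD[OF zariski_closure_superset] S el rational_matrix_elementary rational_matrix_Omega) auto
    moreover have "elementary ?O 1 i ** elementary ?O (-1) i = mat 1"
      unfolding elementary_mult by (simp add: elementary_0 Omega_diag[OF ev])
    ultimately show "\<exists>c g'. c \<noteq> 0 \<and> g' \<in> ?H \<and> elementary ?O c i ** g' = mat 1
        \<and> elementary ?O c i \<in> isometries ?O"
      using el by (intro exI[of _ "1"] exI[of _ "elementary ?O (-1) i"]) auto
  next
    fix M assume "M \<in> isometries ?O" "det (mat 1 + M) \<noteq> 0"
    then show "M \<in> ?H" using S rational_matrix_Omega det_Omega_nz[OF ev] Omega_transpose[OF ev]
      by (intro isometries_dense[of ?O "-1"]) auto
  qed (auto intro: zariski_closure_mult rational_points_mult that simp: det_Omega_nz[OF ev])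
  then show ?thesis by (auto simp: Symplectic points_Symplectic[OF ev] simp del: points.simps)
qed


section \<open>The compact form is Zariski dense\<close>

definition adjoint_matrix :: "complex ^ 'n::finite ^ 'm::finite \<Rightarrow> complex ^ 'm ^ 'n" where
  "adjoint_matrix A = map_matrix cnj (transpose A)"

lemma adjoint_matrix_nth [simp]: "adjoint_matrix A $ i $ j = cnj (A $ j $ i)"
  by (simp add: adjoint_matrix_def transpose_def)

lemma adjoint_matrix_mult: "adjoint_matrix (A ** B) = adjoint_matrix B ** adjoint_matrix A"
  by (simp add: vec_eq_iff matrix_matrix_mult_def mult.commute)

lemma adjoint_matrix_simps:
  "adjoint_matrix (A + B) = adjoint_matrix A + adjoint_matrix B"
  "adjoint_matrix (A - B) = adjoint_matrix A - adjoint_matrix B"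
  "adjoint_matrix (- A) = - adjoint_matrix A"
  "adjoint_matrix (mat c) = mat (cnj c)"
  "adjoint_matrix (adjoint_matrix A) = A"
  by (auto simp: vec_eq_iff mat_def)

lemma unitary_group_iff: "M \<in> unitary_group \<longleftrightarrow> adjoint_matrix M ** M = mat 1"
  using det_nz_if_right_inverse[of "adjoint_matrix M" M] invertible_left_inverse[of M]
  by (auto simp: unitary_group_def adjoint_matrix_def)

lemma unitary_group_mult:
  assumes "A \<in> unitary_group" "B \<in> unitary_group" shows "A ** B \<in> unitary_group"
proof -
  have "adjoint_matrix (A ** B) ** (A ** B) = adjoint_matrix B ** (adjoint_matrix A ** A) ** B"
    by (simp add: adjoint_matrix_mult matrix_mul_assoc)
  then show ?thesis using assms by (simp add: unitary_group_iff)
qed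

lemma unitary_group_adjoint:
  assumes "A \<in> unitary_group" shows "adjoint_matrix A \<in> unitary_group"
  using assms matrix_left_right_inverse[of A] by (simp add: unitary_group_iff adjoint_matrix_simps)

lemma compact_form_mult: "A \<in> compact_form G \<Longrightarrow> B \<in> compact_form G \<Longrightarrow> A ** B \<in> compact_form G"
  by (auto simp: compact_form_def intro: points_mult unitary_group_mult)

lemma det_unitary: "A \<in> unitary_group \<Longrightarrow> cmod (det A) = 1"
proof -
  assume "A \<in> unitary_group"
  then have "det (adjoint_matrix A) * det A = 1"
    by (simp add: unitary_group_iff flip: det_mul)
  moreover have "det (adjoint_matrix A) = cnj (det A)"
  proof -
    have "det (adjoint_matrix A) = det (transpose (adjoint_matrix A))" by simp
    also have "\<dots> = cnj (det A)"
      by (simp add: det_def transpose_def)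
    finally show ?thesis .
  qed
  ultimately have "(cmod (det A))\<^sup>2 = 1"
    by (metis complex_norm_square mult.commute of_real_eq_1_iff)
  then show ?thesis by (simp add: power2_eq_1_iff) (metis norm_ge_zero not_one_le_zero neg_0_le_iff_le)
qed

text \<open>The determinant has modulus one, so the factor of the scaled row cancels in every
  product of a conjugated entry with an entry of that row, and the Gram matrix does not
  change.\<close>

lemma scale_row_unitary:
  fixes A :: "(complex, 't::{finite,linorder}) sq_matrix"
  assumes A: "A \<in> unitary_group" shows "scale_row A \<in> unitary_group"
proof -
  have d: "cnj (det A) * det A = 1"
    using det_unitary[OF A] complex_norm_square[of "det A"] by (simp add: mult.commute)
  have "cnj (scale_row A $ k $ i) * scale_row A $ k $ j = cnj (A $ k $ i) * A $ k $ j" for i j k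
  proof -
    have "cnj (a / det A) * (b / det A) = cnj a * b" for a b
      using d by (simp add: field_simps)
    then show ?thesis by (simp add: scale_row_nth)
  qed
  then have "adjoint_matrix (scale_row A) ** scale_row A = adjoint_matrix A ** A"
    by (simp add: vec_eq_iff matrix_matrix_mult_def)
  then show ?thesis using A by (simp add: unitary_group_iff)
qed

lemma infinite_Reals: "infinite (\<real> :: complex set)"
  by (metis finite_imageD infinite_UNIV_char_0 inj_of_real Reals_def)

text \<open>
  With \<open>X = cayley M\<close> written as \<open>A + \<i> B\<close> for skew-Hermitian \<open>A\<close> and \<open>B\<close>, the curve
  \<open>s \<mapsto> cayley (A + s B)\<close> is unitary for real \<open>s\<close> and passes through \<open>M\<close> at \<open>s = \<i>\<close>.
\<close>

lemma unitary_curve: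
  fixes M J :: "(complex, 't::finite) sq_matrix"
  assumes M: "det (mat 1 + M) \<noteq> 0" "transpose M ** J ** M = J"
    and J: "\<And>Y. transpose Y ** J = - (J ** Y) \<Longrightarrow> transpose (adjoint_matrix Y) ** J = - (J ** adjoint_matrix Y)"
  obtains F where "curve_at \<i> F" "F \<i> = M"
    "infinite {s. F s \<in> unitary_group \<and> transpose (F s) ** J ** F s = J}"
proof -
  define X where "X = cayley M"
  define A where "A = mat (1/2) ** (X - adjoint_matrix X)"
  define B where "B = mat (-\<i>/2) ** (X + adjoint_matrix X)"
  define Z where "Z s = A + mat s ** B" for s
  have XJ: "transpose X ** J = - (J ** X)" unfolding X_def by (rule cayley_skew[OF M])
  \<comment> \<open>The Lie algebra of \<open>J\<close> is closed under adjoints by hypothesis, so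
    it contains \<open>A\<close> and \<open>B\<close>, and the whole curve \<open>Z\<close> stays in
    it.\<close>
  note XJ' = J[OF XJ]
  have smul: "transpose (mat c ** Y) ** J = - (J ** (mat c ** Y))" if "transpose Y ** J = - (J ** Y)" for c and Y
  proof -
    have "transpose (mat c ** Y) ** J = mat c ** (transpose Y ** J)"
      by (simp add: matrix_transpose_mul matrix_mul_assoc mat_mult_commute[of "transpose Y"])
    also have "\<dots> = - (J ** (mat c ** Y))"
      unfolding that by (simp add: matrix_neg_right matrix_mul_assoc mat_mult_commute[of J])
    finally show ?thesis .
  qed
  have add: "transpose (Y + Y') ** J = - (J ** (Y + Y'))"
    if "transpose Y ** J = - (J ** Y)" "transpose Y' ** J = - (J ** Y')" for Y Y'
    using that by (simp add: transpose_add matrix_ring)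
  have diff: "transpose (Y - Y') ** J = - (J ** (Y - Y'))"
    if "transpose Y ** J = - (J ** Y)" "transpose Y' ** J = - (J ** Y')" for Y Y'
    using that by (simp add: transpose_diff matrix_ring)
  have ZJ: "transpose (Z s) ** J = - (J ** Z s)" for s
    unfolding Z_def A_def B_def by (intro add smul diff XJ XJ')
  have Zs: "adjoint_matrix (Z s) = - Z s" if "s \<in> \<real>" for s
    using Reals_cnj_iff[of s] that
    by (simp add: Z_def A_def B_def vec_eq_iff mat_mult_nth algebra_simps)
  have Zi: "Z \<i> = X"
    by (simp add: Z_def A_def B_def vec_eq_iff mat_mult_nth algebra_simps)
  have dZ: "det (mat 1 + Z \<i>) \<noteq> 0" and cZ: "cayley (Z \<i>) = M"
    unfolding Zi X_def using cayley_cayley[OF M(1)] by auto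
  have curve: "curve_at \<i> Z"
    unfolding Z_def by (intro curve_at_add curve_at_mult curve_at_const curve_at_mat rational_at_id)
  show ?thesis
  proof
    show "curve_at \<i> (\<lambda>s. cayley (Z s))"
      by (rule curve_at_cayley[OF curve dZ])
    show "cayley (Z \<i>) = M" by (rule cZ)
    have "finite {s. det (mat 1 + Z s) = 0}"
      by (rule rational_at_finite_zeros[where f = "\<lambda>s. det (mat 1 + Z s)", OF _ dZ]) (intro rational_at_det curve_at_add curve_at_const curve)
    then have "infinite (\<real> - {s. det (mat 1 + Z s) = 0})" using infinite_Reals by simp
    moreover have "cayley (Z s) \<in> unitary_group \<and> transpose (cayley (Z s)) ** J ** cayley (Z s) = J"
      if s: "s \<in> \<real>" "det (mat 1 + Z s) \<noteq> 0" for s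
    proof
      show "transpose (cayley (Z s)) ** J ** cayley (Z s) = J"
        by (rule cayley_form_transpose[OF s(2) ZJ])
      have "adjoint_matrix (cramer_inv (mat 1 + Z s)) ** (mat 1 + adjoint_matrix (Z s)) = mat 1"
        using arg_cong[OF cramer_inv(1)[OF s(2)], of adjoint_matrix]
        by (simp add: adjoint_matrix_mult adjoint_matrix_simps)
      from cayley_form[OF s(2) this, of "mat 1"] show "cayley (Z s) \<in> unitary_group"
        by (simp add: Zs[OF s(1)] unitary_group_iff) (simp add: cayley_def adjoint_matrix_mult adjoint_matrix_simps Zs[OF s(1)])
    qed
    ultimately show "infinite {s. cayley (Z s) \<in> unitary_group \<and> transpose (cayley (Z s)) ** J ** cayley (Z s) = J}"
      by (elim infinite_super[rotated]) auto
  qed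
qed

lemma infinite_unit_circle: "infinite {z :: complex. cmod z = 1}"
proof
  assume fin: "finite {z :: complex. cmod z = 1}"
  have "(\<lambda>x. Complex x (sqrt (1 - x\<^sup>2))) ` {0..1} \<subseteq> {z. cmod z = 1}"
    by (auto simp: cmod_def power_le_one)
  moreover have "inj_on (\<lambda>x. Complex x (sqrt (1 - x\<^sup>2))) {0..1}"
    by (rule inj_onI) simp
  ultimately have "finite {0..1::real}"
    using fin by (meson finite_imageD finite_subset)
  then show False using infinite_Icc[of 0 "1::real"] by simp
qed

lemma cnj_of_rat: "cnj (of_rat q) = of_rat q"
  by (cases q) (simp add: of_rat_rat)

text \<open>The polynomial det(1 + c M) in c has value 1 at 0, so some unimodular c avoids its
  zeros. The curve is drawn through c M and then multiplied by the unitary scalar 1/c.\<close>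

lemma unitary_curve_GL:
  fixes M :: "(complex, 't::finite) sq_matrix"
  assumes "det M \<noteq> 0"
  obtains F where "curve_at \<i> F" "F \<i> = M" "infinite {s. F s \<in> unitary_group}"
proof -
  have "finite {c. det (mat 1 + mat c ** M) = 0}"
    by (rule rational_at_finite_zeros[where f = "\<lambda>c. det (mat 1 + mat c ** M)" and ?s0.0 = 0])
       (intro rational_at_det curve_at_add curve_at_mult curve_at_const curve_at_mat rational_at_id, simp)
  then obtain c where c: "cmod c = 1" "det (mat 1 + mat c ** M) \<noteq> 0"
    using infinite_unit_circle by (metis (mono_tags, lifting) finite_subset mem_Collect_eq subsetI)
  \<comment> \<open>For the form 0 the isometry condition is empty, which leaves unitarity
    alone.\<close>
  obtain F where F: "curve_at \<i> F" "F \<i> = mat c ** M"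
    "infinite {s. F s \<in> unitary_group \<and> transpose (F s) ** 0 ** F s = (0 :: (complex, 't) sq_matrix)}"
    using unitary_curve[of "mat c ** M" 0] c(2) by auto
  have c0: "c \<noteq> 0" using c(1) by auto
  have "mat (1/c) \<in> (unitary_group :: (complex, 't) sq_matrix set)"
    using c complex_norm_square[of c] by (simp add: unitary_group_iff adjoint_matrix_simps mat_mult_mat mult.commute)
  then have *: "{s. F s \<in> unitary_group \<and> transpose (F s) ** 0 ** F s = (0 :: (complex, 't) sq_matrix)}
      \<subseteq> {s. mat (1/c) ** F s \<in> unitary_group}"
    by (auto intro: unitary_group_mult)
  show ?thesis
  proof
    show "curve_at \<i> (\<lambda>s. mat (1/c) ** F s)" using F(1) by (intro curve_at_mult curve_at_const)
    show "mat (1/c) ** F \<i> = M" using c0 by (simp add: F(2) matrix_mul_assoc mat_mult_mat)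
    show "infinite {s. mat (1/c) ** F s \<in> unitary_group}"
      using F(3) * finite_subset by blast
  qed
qed

lemma cnj_Omega: "cnj (Omega $ i $ j) = Omega $ i $ j"
  by (simp add: Omega_def Let_def)

text \<open>Restricting to rational points makes the orthogonal case immediate: they are real, so
  transpose and adjoint agree and they already lie in the compact form.\<close>

theorem compact_form_zariski_dense:
  assumes ev: "G = Symplectic \<Longrightarrow> even CARD('t)"
  shows "rational_points G \<subseteq> zariski_closure (compact_form G :: ((complex, 't::{finite,linorder}) sq_matrix) set)"
proof
  fix M :: "(complex, 't) sq_matrix" assume MG: "M \<in> rational_points G"
  then have M: "M \<in> points G" using rational_points_subset by blast
  show "M \<in> zariski_closure (compact_form G)"
  proof (cases G)
    case General_Linear
    with M have "det M \<noteq> 0" by (simp add: invertible_det_nz)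
    then obtain F where F: "curve_at \<i> F" "F \<i> = M" "infinite {s. F s \<in> unitary_group}"
      by (rule unitary_curve_GL)
    have "{s. F s \<in> unitary_group} \<subseteq> {s. F s \<in> zariski_closure (compact_form General_Linear)}"
      using zariski_closure_superset[of "compact_form General_Linear :: ((complex, 't) sq_matrix) set"]
      by (auto simp: compact_form_def unitary_group_def)
    from zariski_closure_curve[OF F(1) infinite_super[OF this F(3)]] show ?thesis
      by (simp only: F(2) General_Linear)
  next
    case Special_Linear
    with M have d: "det M = 1" by simp
    then have "det M \<noteq> 0" by simp
    then obtain F where F: "curve_at \<i> F" "F \<i> = M" "infinite {s. F s \<in> unitary_group}"
      by (rule unitary_curve_GL)
    have "scale_row (F s) \<in> compact_form Special_Linear" if "F s \<in> unitary_group" for s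
    proof -
      have "det (F s) \<noteq> 0" using det_unitary[OF that] by auto
      then show ?thesis
        using that by (simp add: compact_form_def scale_row_unitary det_scale_row invertible_det_nz)
    qed
    then have sub: "{s. F s \<in> unitary_group} \<subseteq> {s. scale_row (F s) \<in> zariski_closure (compact_form Special_Linear)}"
      using zariski_closure_superset[of "compact_form Special_Linear :: ((complex, 't) sq_matrix) set"] by auto
    have "curve_at \<i> (\<lambda>s. scale_row (F s))"
      using F d by (intro curve_at_scale_row) auto
    from zariski_closure_curve[OF this infinite_super[OF sub F(3)]] show ?thesis
      by (simp only: F(2) Special_Linear scale_row_id[OF d])
  next
    case Orthogonal
    from MG obtain Q where Q: "M = map_matrix of_rat Q" by (auto simp: rational_points_def)
    have "adjoint_matrix M = transpose M"
      by (simp add: Q vec_eq_iff transpose_def cnj_of_rat)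
    then have "M \<in> compact_form Orthogonal"
      using M Orthogonal by (simp add: compact_form_def unitary_group_iff)
    then show ?thesis using zariski_closure_superset Orthogonal by blast
  next
    case Symplectic
    have ev: "even CARD('t)" using ev Symplectic by simp
    let ?O = "Omega :: (complex, 't) sq_matrix"
    let ?H = "zariski_closure (compact_form Symplectic :: ((complex, 't) sq_matrix) set)"
    have el: "elementary ?O c i \<in> isometries ?O" for c i
      by (rule elementary_isometry[where e = "-1"]) (auto simp: Omega_transpose[OF ev] Omega_diag[OF ev])
    have inv: "elementary ?O c i ** elementary ?O (-c) i = mat 1" for c i
      unfolding elementary_mult by (simp add: elementary_0 Omega_diag[OF ev])
    have base: "N \<in> ?H" if N: "N \<in> isometries ?O" "det (mat 1 + N) \<noteq> 0" for N
    proof -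
      \<comment> \<open>\<open>Omega\<close> is real, skew and has square -1: taking the adjoint of
        the equation for \<open>Y\<close> and multiplying by \<open>Omega\<close> on both sides
        gives the equation for the adjoint of \<open>Y\<close>.\<close>
      have J: "transpose (adjoint_matrix Y) ** ?O = - (?O ** adjoint_matrix Y)"
        if Y: "transpose Y ** ?O = - (?O ** Y)" for Y
      proof -
        have aO: "adjoint_matrix ?O = - ?O"
        proof -
          have sk: "?O $ j $ i = - ?O $ i $ j" for i j
            using arg_cong[OF Omega_transpose[OF ev, where 'k = complex], of "\<lambda>A. A $ i $ j"]
            by (simp only: transpose_def mat_mult_nth vec_lambda_beta mult_minus1)
          have "adjoint_matrix ?O $ i $ j = (- ?O) $ i $ j" for i j
            unfolding adjoint_matrix_nth cnj_Omega vector_uminus_component by (rule sk)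
          then show ?thesis by (intro vec_eq_iff[THEN iffD2] allI)
        qed
        have "adjoint_matrix (transpose Y) = transpose (adjoint_matrix Y)"
          by (simp add: vec_eq_iff transpose_def)
        then have "?O ** transpose (adjoint_matrix Y) = - (adjoint_matrix Y ** ?O)"
          using arg_cong[OF Y, of adjoint_matrix]
          by (simp add: adjoint_matrix_mult adjoint_matrix_simps aO matrix_ring minus_equation_iff[of "?O ** _"])
        then have "?O ** (?O ** transpose (adjoint_matrix Y)) ** ?O = - (?O ** adjoint_matrix Y ** (?O ** ?O))"
          by (simp add: matrix_ring)
        then have "(?O ** ?O) ** transpose (adjoint_matrix Y) ** ?O = - (?O ** adjoint_matrix Y ** (?O ** ?O))"
          by (simp only: matrix_mul_assoc)
        then have "mat (-1) ** (transpose (adjoint_matrix Y) ** ?O) = mat (-1) ** - (?O ** adjoint_matrix Y)"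
          unfolding Omega_square[OF ev]
          by (simp add: matrix_mul_assoc mat_mult_commute[of "?O ** adjoint_matrix Y"] matrix_neg_right)
        from arg_cong[OF this, of "(**) (mat (-1))"] show ?thesis
          by (simp add: matrix_mul_assoc mat_mult_mat matrix_neg_right)
      qed
      obtain F where F: "curve_at \<i> F" "F \<i> = N"
        "infinite {s. F s \<in> unitary_group \<and> transpose (F s) ** ?O ** F s = ?O}"
        using unitary_curve[of N ?O] J N by (auto simp: isometries_def)
      have "{s. F s \<in> unitary_group \<and> transpose (F s) ** ?O ** F s = ?O} \<subseteq> {s. F s \<in> ?H}"
        using zariski_closure_superset[of "compact_form Symplectic :: ((complex, 't) sq_matrix) set"]
        by (auto simp: compact_form_def unitary_group_def)
      from zariski_closure_curve[OF F(1) infinite_super[OF this F(3)]] show ?thesis by (simp only: F(2))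
    qed
    have "M \<in> ?H"
    proof (rule isometries_reduction[where J = ?O and H = ?H])
      fix i
      \<comment> \<open>A transvection is not unitary, but adding 1 to it gives twice the
        transvection with half the parameter. That is invertible, so \<open>base\<close>
        applies.\<close>
      have "mat 1 + elementary ?O (-1) i = mat 2 ** elementary ?O (-1/2) i"
        by (simp add: elementary_def matrix_add_ldistrib vec_eq_iff mat_mult_nth) (simp add: mat_def)
      also have "\<dots> ** (elementary ?O (1/2) i ** mat (1/2)) = mat 2 ** (elementary ?O (-1/2) i ** elementary ?O (1/2) i) ** mat (1/2)"
        by (simp only: matrix_mul_assoc)
      also have "\<dots> = mat 1"
        using inv[of "-1/2" i] by (simp add: mat_mult_mat)
      finally have "det (mat 1 + elementary ?O (-1) i) \<noteq> 0"
        by (rule det_nz_if_right_inverse)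
      then have "elementary ?O (-1) i \<in> ?H" using base el by blast
      then show "\<exists>c g'. c \<noteq> 0 \<and> g' \<in> ?H \<and> elementary ?O c i ** g' = mat 1 \<and> elementary ?O c i \<in> isometries ?O"
        using el inv[of 1 i] by (intro exI[of _ "1"] exI[of _ "elementary ?O (-1) i"]) auto
    next
      show "M \<in> isometries ?O" using M Symplectic by (simp add: isometries_def)
    qed (use base in \<open>auto intro: zariski_closure_mult compact_form_mult simp: det_Omega_nz[OF ev]\<close>)
    then show ?thesis using Symplectic by simp
  qed
qed

section \<open>Haar integration of polynomials\<close>

lemma weight_sum_subst_right:
  "weight_sum w (subst_right Y f) = meval Y (\<Sum>I | alpha I f \<noteq> 0. alpha I f * mconst (w I))"
proof -
  have "weight_sum w (subst_right Y f) = (\<Sum>I | alpha I f \<noteq> 0. Poly_Mapping.lookup (subst_right Y f) I * w I)"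
    by (rule weight_sum_superset) (auto simp: alpha_support keys_subst_right[unfolded alpha_support])
  then show ?thesis by (simp add: lookup_subst_right meval_hom)
qed

lemma weight_sum_act:
  fixes f :: "('t::finite \<times> 't, 'k::field_char_0) mpoly"
  shows "weight_sum w (act M f) = meval M (\<Sum>I | alpha I f \<noteq> 0. Poly_Mapping.single I (weight_sum w (alpha I f)))"
  by (simp add: act_eq_alpha weight_sum_sum weight_sum_smult meval_hom) (simp add: mult.commute)

text \<open>For fixed \<open>p\<close> the defect of invariance is itself a polynomial in the
  entries of \<open>N\<close>, so it vanishes on the closure as soon as it vanishes on
  \<open>S\<close>.\<close>

lemma right_invariance_closure:
  assumes "\<And>N. N \<in> S \<Longrightarrow> weight_sum w (subst_right N p) = weight_sum w p" "N \<in> zariski_closure S"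
  shows "weight_sum w (subst_right N p) = weight_sum w p"
proof -
  let ?q = "(\<Sum>I | alpha I p \<noteq> 0. alpha I p * mconst (w I)) - mconst (weight_sum w p)"
  have "meval N ?q = 0"
    by (rule zariski_closureD[OF assms(2)]) (use assms(1) in \<open>simp add: weight_sum_subst_right meval_diff\<close>)
  then show ?thesis by (simp add: weight_sum_subst_right meval_diff)
qed

lemma left_invariance_closure:
  fixes p :: "('t::finite \<times> 't, 'k::field_char_0) mpoly"
  assumes "\<And>N. N \<in> S \<Longrightarrow> weight_sum w (act N p) = weight_sum w p" "N \<in> zariski_closure S"
  shows "weight_sum w (act N p) = weight_sum w p"
proof -
  let ?q = "(\<Sum>I | alpha I p \<noteq> 0. Poly_Mapping.single I (weight_sum w (alpha I p))) - mconst (weight_sum w p)"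
  have "meval N ?q = 0"
    by (rule zariski_closureD[OF assms(2)])
       (use assms(1) in \<open>simp add: weight_sum_act meval_diff del: meval_single\<close>)
  then show ?thesis by (simp add: weight_sum_act meval_diff del: meval_single)
qed

lemma points_inverse:
  assumes M: "M \<in> points G" and N: "M ** N = mat 1" shows "N \<in> points G"
proof -
  have inv: "invertible N" using N matrix_left_right_inverse[of M N] by (auto simp: invertible_def)
  have "transpose N ** J ** N = J" if "transpose M ** J ** M = J" for J
  proof -
    have "transpose N ** J ** N = transpose N ** (transpose M ** J ** M) ** N" using that by simp
    also have "\<dots> = transpose (M ** N) ** J ** (M ** N)"
      by (simp add: matrix_transpose_mul matrix_mul_assoc)
    finally show ?thesis by (simp add: N)
  qed
  moreover have "det N = 1" if "det M = 1"
    using that arg_cong[OF N, of det] by (simp add: det_mul)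
  ultimately show ?thesis using M inv by (cases G) (auto, metis matrix_mul_rid)
qed

lemma compact_form_adjoint:
  assumes "M \<in> compact_form G" shows "adjoint_matrix M \<in> compact_form G" "M ** adjoint_matrix M = mat 1"
proof -
  show 1: "M ** adjoint_matrix M = mat 1"
    using assms by (simp add: compact_form_def unitary_group_iff matrix_left_right_inverse)
  show "adjoint_matrix M \<in> compact_form G"
    using assms points_inverse[OF _ 1] by (auto simp: compact_form_def unitary_group_adjoint)
qed

section \<open>Bounds and continuity of polynomials on the unitary group\<close>

lemma monomial_function_eq: "monomial_function I M = monom_val (entry M) I"
  by (simp add: monomial_function_def monom_val_def case_prod_unfold)

text \<open>The columns of a unitary matrix are unit vectors. The resulting bound on polynomials
  yields integrability against a probability measure.\<close>

lemma unitary_entry_le: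
  assumes "M \<in> unitary_group" shows "cmod (M $ i $ j) \<le> 1"
proof -
  have "(adjoint_matrix M ** M) $ j $ j = 1" using assms by (simp add: unitary_group_iff mat_def)
  then have "(\<Sum>k\<in>UNIV. complex_of_real ((cmod (M $ k $ j))\<^sup>2)) = 1"
    by (simp add: matrix_matrix_mult_def complex_norm_square mult.commute del: of_real_power)
  then have "(\<Sum>k\<in>UNIV. (cmod (M $ k $ j))\<^sup>2) = 1"
    by (metis of_real_eq_1_iff of_real_sum)
  moreover have "(cmod (M $ i $ j))\<^sup>2 \<le> (\<Sum>k\<in>UNIV. (cmod (M $ k $ j))\<^sup>2)"
    by (rule member_le_sum) auto
  ultimately show ?thesis by (metis norm_ge_zero one_power2 power2_le_imp_le zero_le_one)
qed

lemma meval_unitary_bound: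
  assumes "M \<in> unitary_group"
  shows "cmod (meval M p) \<le> (\<Sum>I\<in>Poly_Mapping.keys p. cmod (Poly_Mapping.lookup p I))"
proof -
  have "cmod (monom_val (entry M) I) \<le> 1" for I
    unfolding monom_val_def prod_norm[symmetric]
    by (intro prod_le_1) (auto simp: norm_power power_le_one unitary_entry_le[OF assms])
  then have "cmod (meval M p) \<le> (\<Sum>I\<in>Poly_Mapping.keys p. cmod (Poly_Mapping.lookup p I) * 1)"
    unfolding meval_eq by (intro sum_norm_le) (auto simp: norm_mult intro!: mult_left_le)
  then show ?thesis by simp
qed

lemma continuous_on_meval: "continuous_on UNIV (\<lambda>M :: complex ^ 'n ^ 'm. meval M p)"
  unfolding meval_eq monom_val_def
  by (intro continuous_intros) (auto split: prod.split intro!: continuous_intros)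

lemma continuous_on_matrixI:
  assumes "\<And>i j. continuous_on UNIV (\<lambda>x. F x $ i $ j)"
  shows "continuous_on UNIV (F :: _ \<Rightarrow> complex ^ 'n ^ 'm)"
proof -
  have "continuous_on UNIV (\<lambda>x. \<chi> i. \<chi> j. F x $ i $ j)"
    by (intro continuous_on_vec_lambda assms)
  then show ?thesis by simp
qed

lemma continuous_on_adjoint: "continuous_on UNIV (adjoint_matrix :: complex ^ 'n ^ 'm \<Rightarrow> _)"
  by (rule continuous_on_matrixI) (simp add: continuous_intros)

lemma continuous_on_matrix_mult: "continuous_on UNIV (\<lambda>M :: complex ^ 'n ^ 'm. N ** M)"
  by (rule continuous_on_matrixI) (simp add: matrix_matrix_mult_def, intro continuous_intros)

section \<open>The Haar functional and its two-sided invariance\<close>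

locale compact_haar =
  fixes G :: classical_group and \<mu> :: "(complex, 't::{finite,linorder}) sq_matrix measure"
  assumes haar: "normalised_haar_measure (compact_form G) \<mu>"
begin

abbreviation K :: "(complex, 't) sq_matrix set" where "K \<equiv> compact_form G"

lemma prob: "prob_space \<mu>" and sets_\<mu>: "sets \<mu> = sets (restrict_space borel K)"
  and invariant: "N \<in> K \<Longrightarrow> A \<in> sets \<mu> \<Longrightarrow> emeasure \<mu> ((\<lambda>M. N ** M) ` A) = emeasure \<mu> A"
  using haar unfolding normalised_haar_measure_def by auto

lemma space_\<mu>: "space \<mu> = K"
  using sets_eq_imp_space_eq[OF sets_\<mu>] by (simp add: space_restrict_space)

lemma continuous_measurable:
  fixes f :: "(complex, 't) sq_matrix \<Rightarrow> 'b::topological_space"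
  assumes "continuous_on UNIV f" shows "f \<in> borel_measurable \<mu>"
  using borel_measurable_continuous_onI[OF assms] measurable_restrict_space1[of f borel borel K]
    measurable_cong_sets[OF sets_\<mu> refl] by blast

lemma translate_measurable: "N \<in> K \<Longrightarrow> (\<lambda>M. N ** M) \<in> measurable \<mu> \<mu>"
  unfolding measurable_cong_sets[OF refl sets_\<mu>]
  by (rule measurable_restrict_space2)
     (auto simp: space_\<mu> compact_form_mult intro: continuous_measurable continuous_on_matrix_mult)

text \<open>Invariance is given for images, whereas \<open>distr\<close> uses preimages; a preimage
  under translation by \<open>N\<close> is an image under translation by its inverse, the
  adjoint.\<close>

lemma translate_distr:
  assumes N: "N \<in> K" shows "distr \<mu> \<mu> (\<lambda>M. N ** M) = \<mu>"
proof (rule measure_eqI)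
  fix A assume "A \<in> sets (distr \<mu> \<mu> (\<lambda>M. N ** M))"
  then have A: "A \<in> sets \<mu>" by simp
  then have AK: "A \<subseteq> K" using sets.sets_into_space space_\<mu> by blast
  note N' = compact_form_adjoint[OF N]
  have N'N: "adjoint_matrix N ** N = mat 1"
    using N'(2) by (simp add: matrix_left_right_inverse)
  have "(\<lambda>M. N ** M) -` A \<inter> space \<mu> = (\<lambda>M. adjoint_matrix N ** M) ` A"
  proof (intro set_eqI iffI)
    fix M assume "M \<in> (\<lambda>M. N ** M) -` A \<inter> space \<mu>"
    then have "N ** M \<in> A" by auto
    moreover have "M = adjoint_matrix N ** (N ** M)" by (simp add: matrix_mul_assoc N'N)
    ultimately show "M \<in> (\<lambda>M. adjoint_matrix N ** M) ` A" by (rule image_eqI[rotated])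
  next
    fix M assume "M \<in> (\<lambda>M. adjoint_matrix N ** M) ` A"
    then obtain B where B: "B \<in> A" "M = adjoint_matrix N ** B" by auto
    then have "N ** M = B" by (simp add: matrix_mul_assoc N'(2))
    then show "M \<in> (\<lambda>M. N ** M) -` A \<inter> space \<mu>"
      using B AK N'(1) compact_form_mult by (auto simp: space_\<mu>)
  qed
  then show "emeasure (distr \<mu> \<mu> (\<lambda>M. N ** M)) A = emeasure \<mu> A"
    using invariant[OF N'(1) A] by (simp add: emeasure_distr[OF translate_measurable[OF N] A])
qed simp

lemma integral_translate:
  fixes f :: "(complex, 't) sq_matrix \<Rightarrow> complex"
  assumes "N \<in> K" "continuous_on UNIV f"
  shows "(\<integral>M. f (N ** M) \<partial>\<mu>) = (\<integral>M. f M \<partial>\<mu>)"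
  using integral_distr[OF translate_measurable[OF assms(1)] continuous_measurable[OF assms(2)]]
  by (simp add: translate_distr[OF assms(1)])

lemma integrable_meval: "integrable \<mu> (\<lambda>M. meval M p)"
proof -
  interpret prob_space \<mu> by (rule prob)
  show ?thesis
    by (rule integrable_const_bound[where B = "\<Sum>I\<in>Poly_Mapping.keys p. cmod (Poly_Mapping.lookup p I)"])
       (auto simp: space_\<mu> compact_form_def meval_unitary_bound continuous_measurable continuous_on_meval)
qed

lemma continuous_on_meval_adjoint: "continuous_on UNIV (\<lambda>M :: (complex, 't) sq_matrix. meval (adjoint_matrix M) p)"
  by (rule continuous_on_compose2[OF continuous_on_meval continuous_on_adjoint]) auto

lemma integrable_meval_adjoint: "integrable \<mu> (\<lambda>M. meval (adjoint_matrix M) p)"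
proof -
  interpret prob_space \<mu> by (rule prob)
  show ?thesis
    by (rule integrable_const_bound[where B = "\<Sum>I\<in>Poly_Mapping.keys p. cmod (Poly_Mapping.lookup p I)"])
       (auto simp: space_\<mu> compact_form_def meval_unitary_bound unitary_group_adjoint
          continuous_measurable continuous_on_meval_adjoint)
qed

definition haar_weight :: "('t \<times> 't \<Rightarrow>\<^sub>0 nat) \<Rightarrow> complex" where
  "haar_weight I = (\<integral>M. monomial_function I M \<partial>\<mu>)"

text \<open>The Haar functional composed with inversion, which on \<open>K\<close> is the adjoint.
  Inversion exchanges left and right translations, so this functional is right invariant;
  \<open>weights_unique\<close> identifies it with \<open>haar_weight\<close>, which thereby becomes
  invariant on both sides.\<close>

definition adjoint_weight :: "('t \<times> 't \<Rightarrow>\<^sub>0 nat) \<Rightarrow> complex" where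
  "adjoint_weight I = (\<integral>M. monomial_function I (adjoint_matrix M) \<partial>\<mu>)"

lemma integrable_monom: "integrable \<mu> (\<lambda>M. monom_val (entry M) I)"
  using integrable_meval[of "Poly_Mapping.single I 1"] by simp

lemma integrable_monom_adjoint: "integrable \<mu> (\<lambda>M. monom_val (entry (adjoint_matrix M)) I)"
  using integrable_meval_adjoint[of "Poly_Mapping.single I 1"] by (simp del: adjoint_matrix_nth)

lemma weight_sum_haar: "weight_sum haar_weight p = (\<integral>M. meval M p \<partial>\<mu>)"
  unfolding weight_sum_def haar_weight_def meval_eq monomial_function_eq
  using integrable_monom by (subst Bochner_Integration.integral_sum) auto

lemma weight_sum_adjoint: "weight_sum adjoint_weight p = (\<integral>M. meval (adjoint_matrix M) p \<partial>\<mu>)"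
  unfolding weight_sum_def adjoint_weight_def meval_eq monomial_function_eq
  using integrable_monom_adjoint
  by (subst Bochner_Integration.integral_sum) (auto simp del: adjoint_matrix_nth)

lemma integral_const: "(\<integral>M. c \<partial>\<mu>) = (c :: complex)"
  using prob_space.prob_space[OF prob] by simp

lemma integral_eqI: "(\<And>M. M \<in> K \<Longrightarrow> f M = g M) \<Longrightarrow> (\<integral>M. f M \<partial>\<mu>) = (\<integral>M. g M \<partial>\<mu>)"
  by (rule Bochner_Integration.integral_cong) (auto simp: space_\<mu>)

text \<open>
  Expand \<open>p(MN)\<close> in powers of \<open>M\<close>, apply the functional \<open>x\<close> and integrate over \<open>N\<close>: by right invariance of
  \<open>x\<close> this is \<open>x(p)\<close>, by left invariance of the measure it is the integral of \<open>p\<close>.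
\<close>

lemma weights_unique:
  fixes x :: "('t \<times> 't \<Rightarrow>\<^sub>0 nat) \<Rightarrow> complex"
  assumes x0: "x 0 = 1"
    and vanish: "\<And>p. (\<And>M. M \<in> K \<Longrightarrow> meval M p = 0) \<Longrightarrow> weight_sum x p = 0"
    and right: "\<And>N p. N \<in> K \<Longrightarrow> weight_sum x (subst_right N p) = weight_sum x p"
  shows "x = haar_weight"
proof
  fix I
  define p :: "('t \<times> 't, complex) mpoly" where "p = Poly_Mapping.single I 1"
  define A where "A = {J. alpha J p \<noteq> 0}"
  define b where "b J = (\<integral>N. meval N (alpha J p) \<partial>\<mu>)" for J
  \<comment> \<open>\<open>Q\<close> is the integral of p(MN) over N as a polynomial in M. The
    expansion is a finite sum, so \<open>x\<close> and the integral commute without Fubini's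
    theorem.\<close>
  define Q where "Q = (\<Sum>J\<in>A. Poly_Mapping.single J (b J))"
  have "x I = (\<integral>N. weight_sum x p \<partial>\<mu>)"
    by (simp only: integral_const) (simp add: p_def)
  also have "\<dots> = (\<integral>N. weight_sum x (subst_right N p) \<partial>\<mu>)"
    by (rule integral_eqI) (simp add: right)
  also have "\<dots> = (\<integral>N. (\<Sum>J\<in>A. meval N (alpha J p) * x J) \<partial>\<mu>)"
    by (simp add: weight_sum_subst_right A_def meval_hom)
  also have "\<dots> = (\<Sum>J\<in>A. b J * x J)"
    unfolding b_def using integrable_meval
    by (subst Bochner_Integration.integral_sum) auto
  also have "\<dots> = weight_sum x Q"
    by (simp add: Q_def weight_sum_sum)
  finally have xI: "x I = weight_sum x Q" .
  have "meval M Q = haar_weight I" if M: "M \<in> K" for M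
  proof -
    have "meval M Q = (\<integral>N. (\<Sum>J\<in>A. meval N (alpha J p) * monom_val (entry M) J) \<partial>\<mu>)"
      unfolding Q_def b_def using integrable_meval
      by (subst Bochner_Integration.integral_sum) (auto simp: meval_hom)
    also have "\<dots> = (\<integral>N. meval M (subst_right N p) \<partial>\<mu>)"
      by (intro integral_eqI, subst meval_superset[where A = A])
         (auto simp: A_def lookup_subst_right alpha_support keys_subst_right[unfolded alpha_support])
    also have "\<dots> = (\<integral>N. meval (M ** N) p \<partial>\<mu>)"
      by (simp add: meval_subst_right)
    also have "\<dots> = (\<integral>N. meval N p \<partial>\<mu>)"
      by (rule integral_translate[OF M continuous_on_meval])
    also have "\<dots> = haar_weight I"
      by (simp add: p_def haar_weight_def monomial_function_eq)
    finally show ?thesis .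
  qed
  then have "weight_sum x (Q - mconst (haar_weight I)) = 0"
    by (intro vanish) (simp add: meval_diff)
  then show "x I = haar_weight I"
    by (simp add: xI weight_sum_diff) (simp add: mconst_def x0)
qed

lemma haar_weight_0: "haar_weight 0 = 1"
  by (simp add: haar_weight_def monomial_function_eq integral_const[of 1, simplified])

lemma weight_sum_haar_vanish: "(\<And>M. M \<in> K \<Longrightarrow> meval M p = 0) \<Longrightarrow> weight_sum haar_weight p = 0"
  unfolding weight_sum_haar using integral_eqI[of "\<lambda>M. meval M p" "\<lambda>_. 0"] by simp

lemma adjoint_right_invariant:
  assumes N: "N \<in> K"
  shows "weight_sum adjoint_weight (subst_right N p) = weight_sum adjoint_weight p"
proof -
  have "meval (adjoint_matrix M) (subst_right N p) = meval (adjoint_matrix (adjoint_matrix N ** M)) p" for M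
    by (simp add: meval_subst_right adjoint_matrix_mult adjoint_matrix_simps)
  then show ?thesis
    unfolding weight_sum_adjoint
    using integral_translate[OF compact_form_adjoint(1)[OF N] continuous_on_meval_adjoint] by simp
qed

lemma adjoint_weight_eq: "adjoint_weight = haar_weight"
proof (rule weights_unique)
  show "adjoint_weight 0 = 1"
    by (simp add: adjoint_weight_def monomial_function_eq integral_const[of 1, simplified])
  show "weight_sum adjoint_weight p = 0" if "\<And>M. M \<in> K \<Longrightarrow> meval M p = 0" for p
  proof -
    have "(\<integral>M. meval (adjoint_matrix M) p \<partial>\<mu>) = (\<integral>M. 0 \<partial>\<mu>)"
      by (rule integral_eqI) (simp add: that compact_form_adjoint(1))
    then show ?thesis by (simp add: weight_sum_adjoint)
  qed
qed (rule adjoint_right_invariant)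

lemma haar_right_invariant: "N \<in> K \<Longrightarrow> weight_sum haar_weight (subst_right N p) = weight_sum haar_weight p"
  using adjoint_right_invariant by (simp add: adjoint_weight_eq)

lemma haar_left_invariant: "N \<in> K \<Longrightarrow> weight_sum haar_weight (act N p) = weight_sum haar_weight p"
  unfolding weight_sum_haar meval_act by (rule integral_translate[OF _ continuous_on_meval])

end

section \<open>Rationality of the integrals\<close>

definition rat_linear :: "('k::field_char_0 \<Rightarrow> rat) \<Rightarrow> bool" where
  "rat_linear l \<longleftrightarrow> (\<forall>a b. l (a + b) = l a + l b) \<and> (\<forall>r a. l (of_rat r * a) = r * l a)"

lemma rat_linear_simps:
  assumes "rat_linear l"
  shows "l (a + b) = l a + l b" "l (of_rat r * a) = r * l a" "l (a * of_rat r) = l a * r" "l 0 = 0"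
    "l (a - b) = l a - l b"
proof -
  show 1: "l (a + b) = l a + l b" for a b using assms by (auto simp: rat_linear_def)
  show 2: "l (of_rat r * a) = r * l a" for r a using assms by (auto simp: rat_linear_def)
  show "l (a * of_rat r) = l a * r" using 2 by (simp add: mult.commute)
  show "l 0 = 0" using 2[of 0 0] by simp
  show "l (a - b) = l a - l b" using 1[of "a - b" b] by simp
qed

lemma rat_linear_sum: "rat_linear l \<Longrightarrow> l (sum f A) = (\<Sum>a\<in>A. l (f a))"
  by (induction A rule: infinite_finite_induct) (auto simp: rat_linear_simps)

lemma rat_linear_exists:
  fixes v :: "'k::field_char_0"
  assumes "v \<noteq> 0" shows "\<exists>l. rat_linear l \<and> l v = 1"
proof -
  interpret K: vector_space "\<lambda>r (x :: 'k). of_rat r * x"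
    by unfold_locales (auto simp: algebra_simps of_rat_add of_rat_mult)
  interpret Q: vector_space "(*) :: rat \<Rightarrow> rat \<Rightarrow> rat"
    by unfold_locales (auto simp: algebra_simps)
  interpret P: vector_space_pair "\<lambda>r (x :: 'k). of_rat r * x" "(*) :: rat \<Rightarrow> rat \<Rightarrow> rat" ..
  have "K.independent {v}" using assms by (simp add: K.dependent_single)
  from P.linear_independent_extend[OF this, of "\<lambda>_. 1"] obtain l
    where l: "Vector_Spaces.linear (\<lambda>r (x :: 'k). of_rat r * x) (*) l" "l v = 1" by auto
  interpret L: Vector_Spaces.linear "\<lambda>r (x :: 'k). of_rat r * x" "(*)" l by (rule l(1))
  have "rat_linear l" by (auto simp: rat_linear_def L.add L.scale)
  then show ?thesis using l(2) by blast
qed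

text \<open>Every nonzero element is sent to 1 by some \<rat>-linear map. Identities in
  \<open>'k\<close> can therefore be checked in \<rat>, where they meet the complex side.\<close>

lemma rat_linear_separate:
  assumes "\<And>l. rat_linear l \<Longrightarrow> l a = l b" shows "a = (b :: 'k::field_char_0)"
proof (rule ccontr)
  assume "a \<noteq> b"
  then obtain l where l: "rat_linear l" "l (a - b) = 1" using rat_linear_exists[of "a - b"] by auto
  then show False using assms[OF l(1)] by (simp add: rat_linear_simps)
qed

definition map_coeffs :: "('k::field_char_0 \<Rightarrow> rat) \<Rightarrow> ('v, 'k) mpoly \<Rightarrow> ('v, complex) mpoly" where
  "map_coeffs l p = (\<Sum>m\<in>Poly_Mapping.keys p. Poly_Mapping.single m (of_rat (l (Poly_Mapping.lookup p m))))"

lemma monom_val_of_rat: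
  "monom_val (entry (map_matrix of_rat M)) I = (of_rat (monom_val (entry M) I) :: 'k::field_char_0)"
proof -
  have "entry (map_matrix of_rat M) = (\<lambda>v. of_rat (entry M v) :: 'k)" by auto
  then show ?thesis by (simp add: hom_monom_val[OF semiring_hom_of_rat])
qed

text \<open>At a rational matrix the value is a rational combination of the coefficients, and
  \<open>l\<close> commutes with such combinations. At other matrices the two sides are
  unrelated.\<close>

lemma meval_map_coeffs:
  assumes "rat_linear l"
  shows "meval (map_matrix of_rat M) (map_coeffs l p) = of_rat (l (meval (map_matrix of_rat M) p))"
  by (simp add: map_coeffs_def meval_hom monom_val_of_rat del: nth_map_matrix)
     (simp add: meval_eq monom_val_of_rat rat_linear_sum[OF assms] rat_linear_simps[OF assms] of_rat_sum of_rat_mult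
        del: nth_map_matrix)

lemma map_coeffs_subst_right:
  fixes p :: "('t::finite \<times> 't, 'k::field_char_0) mpoly"
  assumes "rat_linear l"
  shows "map_coeffs l (subst_right (map_matrix of_rat N) p) = subst_right (map_matrix of_rat N) (map_coeffs l p)"
proof (rule meval_eqI)
  fix M :: "rat ^ 't ^ 't"
  have m: "map_matrix of_rat M ** map_matrix of_rat N = (map_matrix of_rat (M ** N) :: ('c::field_char_0, 't) sq_matrix)"
    by (simp add: map_matrix_mult[OF semiring_hom_of_rat])
  show "meval (map_matrix of_rat M) (map_coeffs l (subst_right (map_matrix of_rat N) p))
      = meval (map_matrix of_rat M) (subst_right (map_matrix of_rat N) (map_coeffs l p))"
    by (simp add: meval_map_coeffs[OF assms] meval_subst_right m)
qed

lemma map_coeffs_act: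
  fixes p :: "('t::finite \<times> 't, 'k::field_char_0) mpoly"
  assumes "rat_linear l"
  shows "map_coeffs l (act (map_matrix of_rat N) p) = act (map_matrix of_rat N) (map_coeffs l p)"
proof (rule meval_eqI)
  fix M :: "rat ^ 't ^ 't"
  have m: "map_matrix of_rat N ** map_matrix of_rat M = (map_matrix of_rat (N ** M) :: ('c::field_char_0, 't) sq_matrix)"
    by (simp add: map_matrix_mult[OF semiring_hom_of_rat])
  show "meval (map_matrix of_rat M) (map_coeffs l (act (map_matrix of_rat N) p))
      = meval (map_matrix of_rat M) (act (map_matrix of_rat N) (map_coeffs l p))"
    by (simp add: meval_map_coeffs[OF assms] meval_act m)
qed

text \<open>An arbitrary \<rat>-linear retraction, normalised so that the weight of the constant
  monomial stays 1. By \<open>haar_weight_rational\<close> it leaves the integrals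
  unchanged.\<close>

definition rational_part :: "complex \<Rightarrow> rat" where
  "rational_part = (SOME l. rat_linear l \<and> l 1 = 1)"

lemma rational_part: "rat_linear rational_part" "rational_part 1 = 1"
  using someI_ex[OF rat_linear_exists[of "1 :: complex"]] by (auto simp: rational_part_def)

text \<open>Both sides are the sum of \<open>l\<close> of each coefficient times
  \<open>rational_part (w I)\<close>. This is the bridge from the functional over \<open>'k\<close>
  to the complex one.\<close>

lemma weight_sum_map_coeffs:
  assumes "rat_linear l"
  shows "l (weight_sum (\<lambda>I. of_rat (rational_part (w I))) p) = rational_part (weight_sum w (map_coeffs l p))"
  by (simp add: map_coeffs_def weight_sum_sum rat_linear_sum[OF rational_part(1)] rat_linear_simps[OF rational_part(1)])
     (simp add: weight_sum_def rat_linear_sum[OF assms] rat_linear_simps[OF assms])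

section \<open>The functional with rational weights\<close>

locale compact_haar_even = compact_haar G \<mu>
  for G :: classical_group and \<mu> :: "(complex, 't::{finite,linorder}) sq_matrix measure" +
  assumes even_symplectic: "G = Symplectic \<Longrightarrow> even CARD('t)"
begin

definition rat_weight :: "('t \<times> 't \<Rightarrow>\<^sub>0 nat) \<Rightarrow> rat" where
  "rat_weight I = rational_part (haar_weight I)"

lemma rat_functional:
  "rat_linear l \<Longrightarrow> l (weight_sum (\<lambda>I. of_rat (rat_weight I)) p) = rational_part (weight_sum haar_weight (map_coeffs l p))"
  unfolding rat_weight_def by (rule weight_sum_map_coeffs)

lemma K_subset: "K \<subseteq> zariski_closure (rational_points G)"
  using rational_points_zariski_dense[of G, where 'k = complex and 't = 't, OF even_symplectic]
  by (auto simp: compact_form_def)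

text \<open>After \<open>map_coeffs l\<close> the polynomial vanishes at the complex copies of the
  rational points, hence on their closure, which contains \<open>K\<close>; there the Haar
  functional takes over.\<close>

lemma rat_weight_vanish:
  fixes p :: "('t \<times> 't, 'k::field_char_0) mpoly"
  assumes "\<And>M. M \<in> rational_points G \<Longrightarrow> meval M p = 0"
  shows "weight_sum (\<lambda>I. of_rat (rat_weight I)) p = 0"
proof (rule rat_linear_separate)
  fix l :: "'k \<Rightarrow> rat" assume l: "rat_linear l"
  have "meval M (map_coeffs l p) = 0" if "M \<in> K" for M
  proof (rule zariski_closureD[OF subsetD[OF K_subset that]])
    fix N :: "(complex, 't) sq_matrix" assume "N \<in> rational_points G"
    then obtain Q where Q: "N = map_matrix of_rat Q" "Q \<in> points G" by (auto simp: rational_points_def)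
    then have "meval (map_matrix of_rat Q) p = 0"
      by (intro assms) (auto simp: rational_points_def)
    then show "meval N (map_coeffs l p) = 0"
      by (simp add: Q(1) meval_map_coeffs[OF l] rat_linear_simps[OF l])
  qed
  then show "l (weight_sum (\<lambda>I. of_rat (rat_weight I)) p) = l 0"
    by (simp add: rat_functional[OF l] weight_sum_haar_vanish rat_linear_simps[OF l]
        rat_linear_simps[OF rational_part(1)])
qed

text \<open>Two closures are crossed: among complex matrices invariance passes from \<open>K\<close>
  to the rational points, the maps \<open>l\<close> carry it to the rational points over
  \<open>'k\<close>, and from there it extends to \<open>points G\<close>.\<close>

lemma rat_weight_right:
  fixes p :: "('t \<times> 't, 'k::field_char_0) mpoly"
  assumes "N \<in> points G"
  shows "weight_sum (\<lambda>I. of_rat (rat_weight I)) (subst_right N p) = weight_sum (\<lambda>I. of_rat (rat_weight I)) p"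
proof (rule right_invariance_closure[of "rational_points G"])
  show "N \<in> zariski_closure (rational_points G)"
    using rational_points_zariski_dense[of G, where 'k = 'k and 't = 't, OF even_symplectic] assms by auto
next
  fix N :: "('k, 't) sq_matrix" assume "N \<in> rational_points G"
  then obtain Q where Q: "N = map_matrix of_rat Q" "Q \<in> points G" by (auto simp: rational_points_def)
  have Q': "map_matrix of_rat Q \<in> zariski_closure K"
    using compact_form_zariski_dense[OF even_symplectic] Q(2) by (auto simp: rational_points_def)
  show "weight_sum (\<lambda>I. of_rat (rat_weight I)) (subst_right N p) = weight_sum (\<lambda>I. of_rat (rat_weight I)) p"
  proof (rule rat_linear_separate)
    fix l :: "'k \<Rightarrow> rat" assume l: "rat_linear l"
    show "l (weight_sum (\<lambda>I. of_rat (rat_weight I)) (subst_right N p)) = l (weight_sum (\<lambda>I. of_rat (rat_weight I)) p)"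
      using right_invariance_closure[OF haar_right_invariant Q']
      by (simp add: rat_functional[OF l] Q(1) map_coeffs_subst_right[OF l])
  qed
qed

lemma rat_weight_left:
  fixes p :: "('t \<times> 't, 'k::field_char_0) mpoly"
  assumes "N \<in> points G"
  shows "weight_sum (\<lambda>I. of_rat (rat_weight I)) (act N p) = weight_sum (\<lambda>I. of_rat (rat_weight I)) p"
proof (rule left_invariance_closure[of "rational_points G"])
  show "N \<in> zariski_closure (rational_points G)"
    using rational_points_zariski_dense[of G, where 'k = 'k and 't = 't, OF even_symplectic] assms by auto
next
  fix N :: "('k, 't) sq_matrix" assume "N \<in> rational_points G"
  then obtain Q where Q: "N = map_matrix of_rat Q" "Q \<in> points G" by (auto simp: rational_points_def)
  have Q': "map_matrix of_rat Q \<in> zariski_closure K"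
    using compact_form_zariski_dense[OF even_symplectic] Q(2) by (auto simp: rational_points_def)
  show "weight_sum (\<lambda>I. of_rat (rat_weight I)) (act N p) = weight_sum (\<lambda>I. of_rat (rat_weight I)) p"
  proof (rule rat_linear_separate)
    fix l :: "'k \<Rightarrow> rat" assume l: "rat_linear l"
    show "l (weight_sum (\<lambda>I. of_rat (rat_weight I)) (act N p)) = l (weight_sum (\<lambda>I. of_rat (rat_weight I)) p)"
      using left_invariance_closure[OF haar_left_invariant Q']
      by (simp add: rat_functional[OF l] Q(1) map_coeffs_act[OF l])
  qed
qed

lemma rat_weight_0: "rat_weight 0 = 1"
  by (simp add: rat_weight_def haar_weight_0 rational_part)

lemma haar_weight_rational: "haar_weight I = of_rat (rat_weight I)"
proof -
  have "(\<lambda>I. of_rat (rat_weight I)) = haar_weight"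
  proof (rule weights_unique)
    show "weight_sum (\<lambda>I. of_rat (rat_weight I)) p = 0" if "\<And>M. M \<in> K \<Longrightarrow> meval M p = 0" for p
    proof (rule rat_weight_vanish)
      fix M :: "(complex, 't) sq_matrix" assume "M \<in> rational_points G"
      then have "M \<in> zariski_closure K"
        using compact_form_zariski_dense[OF even_symplectic] by auto
      then show "meval M p = 0" using that by (rule zariski_closureD)
    qed
    show "weight_sum (\<lambda>I. of_rat (rat_weight I)) (subst_right N p) = weight_sum (\<lambda>I. of_rat (rat_weight I)) p"
      if "N \<in> K" for N :: "(complex, 't) sq_matrix" and p
      using that by (intro rat_weight_right) (simp add: compact_form_def)
  qed (simp add: rat_weight_0)
  then show ?thesis by metis
qed

end

section \<open>The Reynolds operator\<close>

lemma vector_space_mpoly: "vector_space (\<lambda>(c :: 'k::field) (p :: ('v, 'k) mpoly). mconst c * p)"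
  by unfold_locales (auto simp: mconst_def single_add mult_single algebra_simps simp flip: mult.assoc)

lemma reynolds_operator_weights:
  fixes x :: "('t::finite \<times> 't \<Rightarrow>\<^sub>0 nat) \<Rightarrow> 'k::field_char_0"
    and f :: "('t \<times> 'n::finite, 'k) mpoly"
  assumes x0: "x 0 = 1"
    and vanish: "\<And>p. (\<And>M. M \<in> S \<Longrightarrow> meval M p = 0) \<Longrightarrow> weight_sum x p = 0"
    and right: "\<And>N p. N \<in> S \<Longrightarrow> weight_sum x (subst_right N p) = weight_sum x p"
    and left: "\<And>N p. N \<in> S \<Longrightarrow> weight_sum x (act N p) = weight_sum x p"
  shows "reynolds_operator S f = (\<Sum>I | alpha I f \<noteq> 0. alpha I f * mconst (x I))"
proof -
  define R :: "('t \<times> 'n, 'k) mpoly \<Rightarrow> ('t \<times> 'n, 'k) mpoly"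
    where "R f = (\<Sum>I | alpha I f \<noteq> 0. alpha I f * mconst (x I))" for f
  have R: "meval Y (R f) = weight_sum x (subst_right Y f)" for Y f
    by (simp add: R_def weight_sum_subst_right)
  \<comment> \<open>The functional depends only on values on \<open>S\<close> and averages constants
    to themselves. This gives both that \<open>R\<close> fixes invariants and that it is the only
    Reynolds operator.\<close>
  have const: "weight_sum x p = c" if "\<And>M. M \<in> S \<Longrightarrow> meval M p = c" for p c
  proof -
    have "weight_sum x (p - mconst c) = 0" using that by (intro vanish) (simp add: meval_diff)
    then show ?thesis by (simp add: weight_sum_diff) (simp add: mconst_def x0)
  qed
  have reynolds: "is_reynolds_operator S R"
    unfolding is_reynolds_operator_def
  proof (intro conjI allI ballI)
    have add: "R (f + g) = R f + R g" for f g
    proof (rule meval_eqI)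
      fix Y :: "rat ^ 'n ^ 't"
      let ?Y = "map_matrix of_rat Y :: 'k ^ 'n ^ 't"
      have "subst_right ?Y (f + g) = subst_right ?Y f + subst_right ?Y g"
        by (rule meval_eqI) (simp add: meval_subst_right meval_hom)
      then show "meval ?Y (R (f + g)) = meval ?Y (R f + R g)"
        by (simp add: R meval_hom weight_sum_add)
    qed
    have scale: "R (mconst c * f) = mconst c * R f" for c f
    proof (rule meval_eqI)
      fix Y :: "rat ^ 'n ^ 't"
      let ?Y = "map_matrix of_rat Y :: 'k ^ 'n ^ 't"
      have "subst_right ?Y (mconst c * f) = mconst c * subst_right ?Y f"
        by (rule meval_eqI) (simp add: meval_subst_right meval_hom)
      then show "meval ?Y (R (mconst c * f)) = meval ?Y (mconst c * R f)"
        by (simp add: R meval_hom weight_sum_smult)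
    qed
    show "Vector_Spaces.linear (\<lambda>c p. mconst c * p) (\<lambda>c p. mconst c * p) R"
      unfolding Vector_Spaces.linear_def module_hom_def module_hom_axioms_def module_iff_vector_space
      using vector_space_mpoly add scale by blast
  next
    fix f show "R f \<in> invariants S"
      unfolding invariants_def mem_Collect_eq
    proof (intro ballI meval_eqI)
      fix M Y assume "M \<in> S"
      then show "meval (map_matrix of_rat Y) (act M (R f)) = meval (map_matrix of_rat Y) (R f)"
        by (simp add: meval_act R subst_right_subst_right right)
    qed
  next
    fix f :: "('t \<times> 'n, 'k) mpoly" assume f: "f \<in> invariants S"
    show "R f = f"
    proof (rule meval_eqI)
      fix Y :: "rat ^ 'n ^ 't"
      let ?Y = "map_matrix of_rat Y :: 'k ^ 'n ^ 't"
      have "meval M (subst_right ?Y f) = meval ?Y f" if "M \<in> S" for M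
        using f that by (simp add: meval_subst_right invariants_def flip: meval_act)
      then show "meval ?Y (R f) = meval ?Y f" unfolding R by (rule const)
    qed
  next
    fix M and f :: "('t \<times> 'n, 'k) mpoly" assume "M \<in> S"
    then show "R (act M f) = R f"
      by (intro meval_eqI) (simp add: R subst_right_act left)
  qed
  have unique: "R' = R" if R': "is_reynolds_operator S R'" for R'
  proof
    fix f
    interpret R': Vector_Spaces.linear "\<lambda>c p. mconst c * p" "\<lambda>c p. mconst c * p" R'
      using R' by (simp add: is_reynolds_operator_def)
    have "R f \<in> invariants S" using reynolds by (simp add: is_reynolds_operator_def)
    then have "R f = R' (R f)" using R' by (simp add: is_reynolds_operator_def)
    also have "\<dots> = R' f"
    proof (rule meval_eqI)
      fix Y :: "rat ^ 'n ^ 't"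
      let ?Y = "map_matrix of_rat Y :: 'k ^ 'n ^ 't"
      \<comment> \<open>\<open>phi f\<close> with \<open>R'\<close> applied to its coefficients and
        then evaluated at \<open>?Y\<close>. At \<open>M\<close> in \<open>S\<close> it takes the
        value of \<open>R' (act M f) = R' f\<close>, so it is constant on \<open>S\<close>.\<close>
      define p where "p = (\<Sum>I | alpha I f \<noteq> 0. Poly_Mapping.single I (meval ?Y (R' (alpha I f))))"
      have "meval ?Y (R' (R f)) = weight_sum x p"
        unfolding R_def p_def
        by (simp add: R'.sum R'.scale mult.commute[of "alpha _ _"] meval_hom weight_sum_sum mult.commute[of "x _"])
      also have "\<dots> = meval ?Y (R' f)"
      proof (rule const)
        fix M assume M: "M \<in> S"
        have "meval ?Y (R' f) = meval ?Y (R' (act M f))"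
          using R' M by (simp add: is_reynolds_operator_def)
        also have "\<dots> = meval M p"
          unfolding act_eq_alpha p_def
          by (simp add: R'.sum R'.scale meval_hom mult.commute[of "monom_val _ _"])
        finally show "meval M p = meval ?Y (R' f)" ..
      qed
      finally show "meval ?Y (R' (R f)) = meval ?Y (R' f)" .
    qed
    finally show "R' f = R f" ..
  qed
  have "reynolds_operator S = R"
    unfolding reynolds_operator_def by (rule the_equality) (rule reynolds, erule unique)
  then show ?thesis by (simp add: R_def)
qed

theorem mainTheorem1:
  fixes G :: classical_group
    and \<mu> :: "(complex ^ 't::{finite,linorder} ^ 't::{finite,linorder}) measure"
  assumes "G = Symplectic \<Longrightarrow> even CARD('t)"
    and "normalised_haar_measure (compact_form G) \<mu>"
  shows "\<exists>q :: ('t \<times> 't \<Rightarrow>\<^sub>0 nat) \<Rightarrow> rat.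
    (\<forall>I. (\<integral>M. monomial_function I M \<partial>\<mu>) = of_rat (q I)) \<and>
    (\<forall>f :: ('t \<times> 'n::finite, 'k::field_char_0) mpoly.
       reynolds_operator (points G) f =
         (\<Sum>I | alpha I f \<noteq> 0. alpha I f * mconst (of_rat (q I))))"
proof -
  interpret compact_haar_even G \<mu> by unfold_locales (use assms in auto)
  show ?thesis
  proof (intro exI conjI allI)
    fix I show "(\<integral>M. monomial_function I M \<partial>\<mu>) = of_rat (rat_weight I)"
      using haar_weight_rational by (simp add: haar_weight_def)
  next
    fix f :: "('t \<times> 'n, 'k) mpoly"
    show "reynolds_operator (points G) f = (\<Sum>I | alpha I f \<noteq> 0. alpha I f * mconst (of_rat (rat_weight I)))"
    proof (rule reynolds_operator_weights)
      show "weight_sum (\<lambda>I. of_rat (rat_weight I)) p = 0"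
        if "\<And>M. M \<in> points G \<Longrightarrow> meval M p = 0" for p :: "('t \<times> 't, 'k) mpoly"
        using that rational_points_subset by (intro rat_weight_vanish) blast
    qed (simp_all add: rat_weight_0 rat_weight_right rat_weight_left)
  qed
qed

end
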